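(* Let $\mathbb{X}$ be an additive linear category with monoidal coalgebra modality $(!,\delta,\varepsilon,m_\otimes,m_K,\Delta,e)$, and let $\nabla:=(\delta\otimes\delta)m_\otimes!(\varepsilon\otimes e+e\otimes\varepsilon)$ and $u:=m_K!(0)$ be the multiplication and unit of the induced additive bialgebra modality. For a natural transformation $\eta:A\to{!A}$ consider the rules: - linear: $\eta\varepsilon=1$; - chain: $(1\otimes\eta)\nabla\delta=(\Delta\otimes\eta)(1\otimes\nabla)(\delta\otimes\eta)\nabla$ as maps ${!A}\otimes A\to{!!A}$; - alternative chain: $\eta\delta=(u\otimes\eta)(\delta\otimes\eta)\nabla$ as maps $A\to{!!A}$; - monoidal: $(1\otimes\eta)m_\otimes=(\varepsilon\otimes1)\eta$ as maps ${!A}\otimes B\to{!(A\otimes B)}$. Then the following are equivalent: (i) $\eta$ is a codereliction for the induced additive bialgebra modality; (ii) $\eta$ satisfies the linear rule and the chain rule; (iii) $\eta$ satisfies the linear rule, the alternative chain rule and the monoidal rule.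
   Context: Composition is in diagrammatic order ($fg$ means first $f$, then $g$). Symmetric monoidal categories are treated as strict (associators and unitors suppressed), with tensor $\otimes$, unit $K$, symmetry $\sigma:A\otimes B\to B\otimes A$. An additive symmetric monoidal category is a symmetric monoidal category enriched in commutative monoids (hom-sets have $+$ and $0$, no negatives, no biproducts assumed), with composition and $\otimes$ preserving $+$ and $0$ in each variable. A coalgebra modality $(!,\delta,\varepsilon,\Delta,e)$ is a comonad $(!,\delta,\varepsilon)$, $\delta:{!A}\to{!!A}$, $\varepsilon:{!A}\to A$, with natural transformations $\Delta:{!A}\to{!A}\otimes{!A}$, $e:{!A}\to K$ such that each $({!A},\Delta,e)$ is a cocommutative comonoid and $\delta\Delta=\Delta(\delta\otimes\delta)$. A monoidal coalgebra modality $(!,\delta,\varepsilon,m_\otimes,m_K,\Delta,e)$ is a coalgebra modality with a natural transformation $m_\otimes:{!A}\otimes{!B}\to{!(A\otimes B)}$ and a map $m_K:K\to{!K}$ such that: $(!,m_\otimes,m_K)$ is a (lax) symmetric monoidal endofunctor; $\delta,\varepsilon$ are monoidal: $m_\otimes\delta=(\delta\otimes\delta)m_\otimes!(m_\otimes)$, $m_K\delta=m_K!(m_K)$, $m_\otimes\varepsilon=\varepsilon\otimes\varepsilon$, $m_K\varepsilon=1$; $\Delta,e$ are monoidal: $m_\otimes\Delta=(\Delta\otimes\Delta)(1\otimes\sigma\otimes1)(m_\otimes\otimes m_\otimes)$, $m_\otimes e=e\otimes e$, $m_K\Delta=m_K\otimes m_K$, $m_Ke=1$; and $\Delta,e$ are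 $!$-coalgebra morphisms: $\delta\,!(\Delta)=\Delta(\delta\otimes\delta)m_\otimes$, $\delta\,!(e)=e\,m_K$. An additive linear category is an additive symmetric monoidal category equipped with a monoidal coalgebra modality. A codereliction is a natural transformation $\eta:A\to{!A}$ satisfying the constant rule $\eta e=0$, the product rule $\eta\Delta=\eta\otimes u+u\otimes\eta$, and the linear and chain rules listed in the claim. In the chain and alternative chain rules, the second $\eta$ occurring on the right-hand side is the component at ${!A}$. *)

theory Defs
  imports Main
begin

text \<open>
  Composition \<open>f \<Zsemi> g\<close> is in diagrammatic order.  All operations on arrows are total functions
  on the type of arrows and are constrained only on the (pairwise disjoint) hom-sets.
\<close>

subsection \<open>Categories\<close>

record ('o, 'a) category =
  Obj :: "'o set"
  Hom :: "'o \<Rightarrow> 'o \<Rightarrow> 'a set"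
  ident :: "'o \<Rightarrow> 'a" (\<open>\<^bold>1\<index>\<close>)
  seq :: "'a \<Rightarrow> 'a \<Rightarrow> 'a" (infixl \<open>\<Zsemi>\<index>\<close> 70)

locale category =
  fixes X :: "('o, 'a, 'z) category_scheme" (structure)
  assumes Hom_Obj: "f \<in> Hom X A B \<Longrightarrow> A \<in> Obj X \<and> B \<in> Obj X"
    and Hom_disjoint: "f \<in> Hom X A B \<Longrightarrow> f \<in> Hom X C D \<Longrightarrow> A = C \<and> B = D"
    and ident_Hom: "A \<in> Obj X \<Longrightarrow> \<^bold>1 A \<in> Hom X A A"
    and seq_Hom: "f \<in> Hom X A B \<Longrightarrow> g \<in> Hom X B C \<Longrightarrow> f \<Zsemi> g \<in> Hom X A C"
    and ident_seq: "f \<in> Hom X A B \<Longrightarrow> \<^bold>1 A \<Zsemi> f = f"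
    and seq_ident: "f \<in> Hom X A B \<Longrightarrow> f \<Zsemi> \<^bold>1 B = f"
    and seq_assoc: "f \<in> Hom X A B \<Longrightarrow> g \<in> Hom X B C \<Longrightarrow> h \<in> Hom X C D
      \<Longrightarrow> (f \<Zsemi> g) \<Zsemi> h = f \<Zsemi> (g \<Zsemi> h)"

text \<open>Endofunctors and natural transformations between them; a functor is given by its action on
  objects \<open>F\<^sub>o\<close> and on arrows \<open>F\<close>.\<close>

definition endofunctor ::
    "('o, 'a, 'z) category_scheme \<Rightarrow> ('o \<Rightarrow> 'o) \<Rightarrow> ('a \<Rightarrow> 'a) \<Rightarrow> bool" where
  "endofunctor X F\<^sub>o F \<longleftrightarrow>
     (\<forall>A\<in>Obj X. F\<^sub>o A \<in> Obj X) \<and>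
     (\<forall>A B. \<forall>f\<in>Hom X A B. F f \<in> Hom X (F\<^sub>o A) (F\<^sub>o B)) \<and>
     (\<forall>A\<in>Obj X. F (\<^bold>1\<^bsub>X\<^esub> A) = \<^bold>1\<^bsub>X\<^esub> (F\<^sub>o A)) \<and>
     (\<forall>A B C. \<forall>f\<in>Hom X A B. \<forall>g\<in>Hom X B C. F (f \<Zsemi>\<^bsub>X\<^esub> g) = F f \<Zsemi>\<^bsub>X\<^esub> F g)"

definition natural_transformation ::
    "('o, 'a, 'z) category_scheme \<Rightarrow> ('o \<Rightarrow> 'o) \<Rightarrow> ('a \<Rightarrow> 'a) \<Rightarrow> ('o \<Rightarrow> 'o) \<Rightarrow> ('a \<Rightarrow> 'a)
      \<Rightarrow> ('o \<Rightarrow> 'a) \<Rightarrow> bool" where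
  "natural_transformation X F\<^sub>o F G\<^sub>o G \<tau> \<longleftrightarrow>
     (\<forall>A\<in>Obj X. \<tau> A \<in> Hom X (F\<^sub>o A) (G\<^sub>o A)) \<and>
     (\<forall>A B. \<forall>f\<in>Hom X A B. F f \<Zsemi>\<^bsub>X\<^esub> \<tau> B = \<tau> A \<Zsemi>\<^bsub>X\<^esub> G f)"

subsection \<open>Additive (strict) symmetric monoidal categories\<close>

text \<open>Associators and unitors are suppressed: the tensor product is strictly associative and unital,
  on objects and on arrows.\<close>

record ('o, 'a) sym_mon_category = "('o, 'a) category" +
  tensor_obj :: "'o \<Rightarrow> 'o \<Rightarrow> 'o" (infixr \<open>\<otimes>\<^sub>o\<index>\<close> 75)
  tensor :: "'a \<Rightarrow> 'a \<Rightarrow> 'a" (infixr \<open>\<otimes>\<index>\<close> 75)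
  unit_obj :: "'o" (\<open>\<^bold>K\<index>\<close>)
  symmetry :: "'o \<Rightarrow> 'o \<Rightarrow> 'a" (\<open>\<sigma>\<index>\<close>)

locale sym_mon_category = category X
  for X :: "('o, 'a, 'z) sym_mon_category_scheme" (structure) +
  assumes unit_Obj: "\<^bold>K \<in> Obj X"
    and tensor_Obj: "A \<in> Obj X \<Longrightarrow> B \<in> Obj X \<Longrightarrow> A \<otimes>\<^sub>o B \<in> Obj X"
    and tensor_obj_assoc: "A \<in> Obj X \<Longrightarrow> B \<in> Obj X \<Longrightarrow> C \<in> Obj X
      \<Longrightarrow> (A \<otimes>\<^sub>o B) \<otimes>\<^sub>o C = A \<otimes>\<^sub>o (B \<otimes>\<^sub>o C)"
    and unit_tensor_obj: "A \<in> Obj X \<Longrightarrow> \<^bold>K \<otimes>\<^sub>o A = A"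
    and tensor_obj_unit: "A \<in> Obj X \<Longrightarrow> A \<otimes>\<^sub>o \<^bold>K = A"
    and tensor_Hom: "f \<in> Hom X A B \<Longrightarrow> g \<in> Hom X C D
      \<Longrightarrow> f \<otimes> g \<in> Hom X (A \<otimes>\<^sub>o C) (B \<otimes>\<^sub>o D)"
    and tensor_ident: "A \<in> Obj X \<Longrightarrow> B \<in> Obj X \<Longrightarrow> \<^bold>1 A \<otimes> \<^bold>1 B = \<^bold>1 (A \<otimes>\<^sub>o B)"
    and interchange: "f \<in> Hom X A B \<Longrightarrow> g \<in> Hom X B C \<Longrightarrow> h \<in> Hom X D E \<Longrightarrow> k \<in> Hom X E F
      \<Longrightarrow> (f \<Zsemi> g) \<otimes> (h \<Zsemi> k) = (f \<otimes> h) \<Zsemi> (g \<otimes> k)"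
    and tensor_assoc: "f \<in> Hom X A B \<Longrightarrow> g \<in> Hom X C D \<Longrightarrow> h \<in> Hom X E F
      \<Longrightarrow> (f \<otimes> g) \<otimes> h = f \<otimes> (g \<otimes> h)"
    and unit_tensor: "f \<in> Hom X A B \<Longrightarrow> \<^bold>1 \<^bold>K \<otimes> f = f"
    and tensor_unit: "f \<in> Hom X A B \<Longrightarrow> f \<otimes> \<^bold>1 \<^bold>K = f"
    and symmetry_Hom: "A \<in> Obj X \<Longrightarrow> B \<in> Obj X \<Longrightarrow> \<sigma> A B \<in> Hom X (A \<otimes>\<^sub>o B) (B \<otimes>\<^sub>o A)"
    and symmetry_natural: "f \<in> Hom X A B \<Longrightarrow> g \<in> Hom X C D
      \<Longrightarrow> (f \<otimes> g) \<Zsemi> \<sigma> B D = \<sigma> A C \<Zsemi> (g \<otimes> f)"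
    and symmetry_inverse: "A \<in> Obj X \<Longrightarrow> B \<in> Obj X \<Longrightarrow> \<sigma> A B \<Zsemi> \<sigma> B A = \<^bold>1 (A \<otimes>\<^sub>o B)"
    and hexagon: "A \<in> Obj X \<Longrightarrow> B \<in> Obj X \<Longrightarrow> C \<in> Obj X
      \<Longrightarrow> \<sigma> A (B \<otimes>\<^sub>o C) = (\<sigma> A B \<otimes> \<^bold>1 C) \<Zsemi> (\<^bold>1 B \<otimes> \<sigma> A C)"

text \<open>Here \<open>f \<oplus> g\<close> is the sum of parallel arrows, not a biproduct.\<close>

record ('o, 'a) additive_category = "('o, 'a) sym_mon_category" +
  add :: "'a \<Rightarrow> 'a \<Rightarrow> 'a" (infixl \<open>\<oplus>\<index>\<close> 65)
  zero_arr :: "'o \<Rightarrow> 'o \<Rightarrow> 'a" (\<open>\<^bold>0\<index>\<close>)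

locale additive_sym_mon_category = sym_mon_category X
  for X :: "('o, 'a, 'z) additive_category_scheme" (structure) +
  assumes zero_Hom: "A \<in> Obj X \<Longrightarrow> B \<in> Obj X \<Longrightarrow> \<^bold>0 A B \<in> Hom X A B"
    and add_Hom: "f \<in> Hom X A B \<Longrightarrow> g \<in> Hom X A B \<Longrightarrow> f \<oplus> g \<in> Hom X A B"
    and add_assoc: "f \<in> Hom X A B \<Longrightarrow> g \<in> Hom X A B \<Longrightarrow> h \<in> Hom X A B
      \<Longrightarrow> (f \<oplus> g) \<oplus> h = f \<oplus> (g \<oplus> h)"
    and add_commute: "f \<in> Hom X A B \<Longrightarrow> g \<in> Hom X A B \<Longrightarrow> f \<oplus> g = g \<oplus> f"
    and zero_add: "f \<in> Hom X A B \<Longrightarrow> \<^bold>0 A B \<oplus> f = f"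
    and seq_add_left: "f \<in> Hom X A B \<Longrightarrow> g \<in> Hom X A B \<Longrightarrow> h \<in> Hom X B C
      \<Longrightarrow> (f \<oplus> g) \<Zsemi> h = f \<Zsemi> h \<oplus> g \<Zsemi> h"
    and seq_add_right: "f \<in> Hom X A B \<Longrightarrow> g \<in> Hom X B C \<Longrightarrow> h \<in> Hom X B C
      \<Longrightarrow> f \<Zsemi> (g \<oplus> h) = f \<Zsemi> g \<oplus> f \<Zsemi> h"
    and zero_seq: "A \<in> Obj X \<Longrightarrow> f \<in> Hom X B C \<Longrightarrow> \<^bold>0 A B \<Zsemi> f = \<^bold>0 A C"
    and seq_zero: "f \<in> Hom X A B \<Longrightarrow> C \<in> Obj X \<Longrightarrow> f \<Zsemi> \<^bold>0 B C = \<^bold>0 A C"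
    and tensor_add_left: "f \<in> Hom X A B \<Longrightarrow> g \<in> Hom X A B \<Longrightarrow> h \<in> Hom X C D
      \<Longrightarrow> (f \<oplus> g) \<otimes> h = f \<otimes> h \<oplus> g \<otimes> h"
    and tensor_add_right: "f \<in> Hom X A B \<Longrightarrow> g \<in> Hom X C D \<Longrightarrow> h \<in> Hom X C D
      \<Longrightarrow> f \<otimes> (g \<oplus> h) = f \<otimes> g \<oplus> f \<otimes> h"
    and zero_tensor: "A \<in> Obj X \<Longrightarrow> B \<in> Obj X \<Longrightarrow> f \<in> Hom X C D
      \<Longrightarrow> \<^bold>0 A B \<otimes> f = \<^bold>0 (A \<otimes>\<^sub>o C) (B \<otimes>\<^sub>o D)"
    and tensor_zero: "A \<in> Obj X \<Longrightarrow> B \<in> Obj X \<Longrightarrow> f \<in> Hom X C D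
      \<Longrightarrow> f \<otimes> \<^bold>0 A B = \<^bold>0 (C \<otimes>\<^sub>o A) (D \<otimes>\<^sub>o B)"

subsection \<open>Coalgebra modalities\<close>

record ('o, 'a) coalgebra_modality = "('o, 'a) additive_category" +
  bang_obj :: "'o \<Rightarrow> 'o" (\<open>\<^bold>!\<^sub>o\<index>\<close>)
  bang :: "'a \<Rightarrow> 'a" (\<open>\<^bold>!\<index>\<close>)
  comult :: "'o \<Rightarrow> 'a" (\<open>\<delta>\<index>\<close>)
  counit :: "'o \<Rightarrow> 'a" (\<open>\<epsilon>\<index>\<close>)
  dupl :: "'o \<Rightarrow> 'a" (\<open>\<Delta>\<index>\<close>)
  disc :: "'o \<Rightarrow> 'a" (\<open>\<^bold>e\<index>\<close>)

locale coalgebra_modality = additive_sym_mon_category X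
  for X :: "('o, 'a, 'z) coalgebra_modality_scheme" (structure) +
  assumes bang_functor: "endofunctor X \<^bold>!\<^sub>o \<^bold>!"
    and comult_natural:
      "natural_transformation X \<^bold>!\<^sub>o \<^bold>! (\<lambda>A. \<^bold>!\<^sub>o (\<^bold>!\<^sub>o A)) (\<lambda>f. \<^bold>! (\<^bold>! f)) \<delta>"
    and counit_natural:
      "natural_transformation X \<^bold>!\<^sub>o \<^bold>! (\<lambda>A. A) (\<lambda>f. f) \<epsilon>"
    and comult_counit: "A \<in> Obj X \<Longrightarrow> \<delta> A \<Zsemi> \<epsilon> (\<^bold>!\<^sub>o A) = \<^bold>1 (\<^bold>!\<^sub>o A)"
    and comult_bang_counit: "A \<in> Obj X \<Longrightarrow> \<delta> A \<Zsemi> \<^bold>! (\<epsilon> A) = \<^bold>1 (\<^bold>!\<^sub>o A)"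
    and comult_comult: "A \<in> Obj X \<Longrightarrow> \<delta> A \<Zsemi> \<delta> (\<^bold>!\<^sub>o A) = \<delta> A \<Zsemi> \<^bold>! (\<delta> A)"
    and dupl_natural:
      "natural_transformation X \<^bold>!\<^sub>o \<^bold>! (\<lambda>A. \<^bold>!\<^sub>o A \<otimes>\<^sub>o \<^bold>!\<^sub>o A) (\<lambda>f. \<^bold>! f \<otimes> \<^bold>! f) \<Delta>"
    and disc_natural:
      "natural_transformation X \<^bold>!\<^sub>o \<^bold>! (\<lambda>A. \<^bold>K) (\<lambda>f. \<^bold>1 \<^bold>K) \<^bold>e"
    and dupl_assoc: "A \<in> Obj X
      \<Longrightarrow> \<Delta> A \<Zsemi> (\<Delta> A \<otimes> \<^bold>1 (\<^bold>!\<^sub>o A)) = \<Delta> A \<Zsemi> (\<^bold>1 (\<^bold>!\<^sub>o A) \<otimes> \<Delta> A)"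
    and dupl_disc_left: "A \<in> Obj X \<Longrightarrow> \<Delta> A \<Zsemi> (\<^bold>e A \<otimes> \<^bold>1 (\<^bold>!\<^sub>o A)) = \<^bold>1 (\<^bold>!\<^sub>o A)"
    and dupl_disc_right: "A \<in> Obj X \<Longrightarrow> \<Delta> A \<Zsemi> (\<^bold>1 (\<^bold>!\<^sub>o A) \<otimes> \<^bold>e A) = \<^bold>1 (\<^bold>!\<^sub>o A)"
    and dupl_commute: "A \<in> Obj X \<Longrightarrow> \<Delta> A \<Zsemi> \<sigma> (\<^bold>!\<^sub>o A) (\<^bold>!\<^sub>o A) = \<Delta> A"
    and comult_dupl: "A \<in> Obj X \<Longrightarrow> \<delta> A \<Zsemi> \<Delta> (\<^bold>!\<^sub>o A) = \<Delta> A \<Zsemi> (\<delta> A \<otimes> \<delta> A)"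

record ('o, 'a) monoidal_coalgebra_modality = "('o, 'a) coalgebra_modality" +
  mon_tensor :: "'o \<Rightarrow> 'o \<Rightarrow> 'a" (\<open>\<^bold>m\<index>\<close>)
  mon_unit :: "'a" (\<open>\<^bold>m\<^sub>K\<index>\<close>)

locale additive_linear_category = coalgebra_modality X
  for X :: "('o, 'a, 'z) monoidal_coalgebra_modality_scheme" (structure) +
  assumes m_Hom: "A \<in> Obj X \<Longrightarrow> B \<in> Obj X
      \<Longrightarrow> \<^bold>m A B \<in> Hom X (\<^bold>!\<^sub>o A \<otimes>\<^sub>o \<^bold>!\<^sub>o B) (\<^bold>!\<^sub>o (A \<otimes>\<^sub>o B))"
    and m_natural: "f \<in> Hom X A B \<Longrightarrow> g \<in> Hom X C D
      \<Longrightarrow> (\<^bold>! f \<otimes> \<^bold>! g) \<Zsemi> \<^bold>m B D = \<^bold>m A C \<Zsemi> \<^bold>! (f \<otimes> g)"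
    and mK_Hom: "\<^bold>m\<^sub>K \<in> Hom X \<^bold>K (\<^bold>!\<^sub>o \<^bold>K)"
    and m_assoc: "A \<in> Obj X \<Longrightarrow> B \<in> Obj X \<Longrightarrow> C \<in> Obj X
      \<Longrightarrow> (\<^bold>m A B \<otimes> \<^bold>1 (\<^bold>!\<^sub>o C)) \<Zsemi> \<^bold>m (A \<otimes>\<^sub>o B) C = (\<^bold>1 (\<^bold>!\<^sub>o A) \<otimes> \<^bold>m B C) \<Zsemi> \<^bold>m A (B \<otimes>\<^sub>o C)"
    and m_unit_left: "A \<in> Obj X \<Longrightarrow> (\<^bold>m\<^sub>K \<otimes> \<^bold>1 (\<^bold>!\<^sub>o A)) \<Zsemi> \<^bold>m \<^bold>K A = \<^bold>1 (\<^bold>!\<^sub>o A)"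
    and m_unit_right: "A \<in> Obj X \<Longrightarrow> (\<^bold>1 (\<^bold>!\<^sub>o A) \<otimes> \<^bold>m\<^sub>K) \<Zsemi> \<^bold>m A \<^bold>K = \<^bold>1 (\<^bold>!\<^sub>o A)"
    and m_symmetry: "A \<in> Obj X \<Longrightarrow> B \<in> Obj X
      \<Longrightarrow> \<^bold>m A B \<Zsemi> \<^bold>! (\<sigma> A B) = \<sigma> (\<^bold>!\<^sub>o A) (\<^bold>!\<^sub>o B) \<Zsemi> \<^bold>m B A"
    and m_comult: "A \<in> Obj X \<Longrightarrow> B \<in> Obj X
      \<Longrightarrow> \<^bold>m A B \<Zsemi> \<delta> (A \<otimes>\<^sub>o B) = (\<delta> A \<otimes> \<delta> B) \<Zsemi> \<^bold>m (\<^bold>!\<^sub>o A) (\<^bold>!\<^sub>o B) \<Zsemi> \<^bold>! (\<^bold>m A B)"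
    and mK_comult: "\<^bold>m\<^sub>K \<Zsemi> \<delta> \<^bold>K = \<^bold>m\<^sub>K \<Zsemi> \<^bold>! \<^bold>m\<^sub>K"
    and m_counit: "A \<in> Obj X \<Longrightarrow> B \<in> Obj X \<Longrightarrow> \<^bold>m A B \<Zsemi> \<epsilon> (A \<otimes>\<^sub>o B) = \<epsilon> A \<otimes> \<epsilon> B"
    and mK_counit: "\<^bold>m\<^sub>K \<Zsemi> \<epsilon> \<^bold>K = \<^bold>1 \<^bold>K"
    and m_dupl: "A \<in> Obj X \<Longrightarrow> B \<in> Obj X
      \<Longrightarrow> \<^bold>m A B \<Zsemi> \<Delta> (A \<otimes>\<^sub>o B) =
          (\<Delta> A \<otimes> \<Delta> B) \<Zsemi> (\<^bold>1 (\<^bold>!\<^sub>o A) \<otimes> \<sigma> (\<^bold>!\<^sub>o A) (\<^bold>!\<^sub>o B) \<otimes> \<^bold>1 (\<^bold>!\<^sub>o B)) \<Zsemi> (\<^bold>m A B \<otimes> \<^bold>m A B)"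
    and m_disc: "A \<in> Obj X \<Longrightarrow> B \<in> Obj X \<Longrightarrow> \<^bold>m A B \<Zsemi> \<^bold>e (A \<otimes>\<^sub>o B) = \<^bold>e A \<otimes> \<^bold>e B"
    and mK_dupl: "\<^bold>m\<^sub>K \<Zsemi> \<Delta> \<^bold>K = \<^bold>m\<^sub>K \<otimes> \<^bold>m\<^sub>K"
    and mK_disc: "\<^bold>m\<^sub>K \<Zsemi> \<^bold>e \<^bold>K = \<^bold>1 \<^bold>K"
    and comult_bang_dupl: "A \<in> Obj X
      \<Longrightarrow> \<delta> A \<Zsemi> \<^bold>! (\<Delta> A) = \<Delta> A \<Zsemi> (\<delta> A \<otimes> \<delta> A) \<Zsemi> \<^bold>m (\<^bold>!\<^sub>o A) (\<^bold>!\<^sub>o A)"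
    and comult_bang_disc: "A \<in> Obj X \<Longrightarrow> \<delta> A \<Zsemi> \<^bold>! (\<^bold>e A) = \<^bold>e A \<Zsemi> \<^bold>m\<^sub>K"

subsection \<open>The induced multiplication and unit\<close>

definition ind_mult ::
    "('o, 'a, 'z) monoidal_coalgebra_modality_scheme \<Rightarrow> 'o \<Rightarrow> 'a" (\<open>\<nabla>\<index>\<close>) where
  "\<nabla>\<^bsub>X\<^esub> A = (\<delta>\<^bsub>X\<^esub> A \<otimes>\<^bsub>X\<^esub> \<delta>\<^bsub>X\<^esub> A) \<Zsemi>\<^bsub>X\<^esub> \<^bold>m\<^bsub>X\<^esub> (\<^bold>!\<^sub>o\<^bsub>X\<^esub> A) (\<^bold>!\<^sub>o\<^bsub>X\<^esub> A)
     \<Zsemi>\<^bsub>X\<^esub> \<^bold>!\<^bsub>X\<^esub> (\<epsilon>\<^bsub>X\<^esub> A \<otimes>\<^bsub>X\<^esub> \<^bold>e\<^bsub>X\<^esub> A \<oplus>\<^bsub>X\<^esub> \<^bold>e\<^bsub>X\<^esub> A \<otimes>\<^bsub>X\<^esub> \<epsilon>\<^bsub>X\<^esub> A)"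

definition ind_unit ::
    "('o, 'a, 'z) monoidal_coalgebra_modality_scheme \<Rightarrow> 'o \<Rightarrow> 'a" (\<open>\<^bold>u\<index>\<close>) where
  "\<^bold>u\<^bsub>X\<^esub> A = \<^bold>m\<^sub>K\<^bsub>X\<^esub> \<Zsemi>\<^bsub>X\<^esub> \<^bold>!\<^bsub>X\<^esub> (\<^bold>0\<^bsub>X\<^esub> \<^bold>K\<^bsub>X\<^esub> A)"

subsection \<open>Coderelictions\<close>

text \<open>In the rules that involve them, the multiplication \<open>mu\<close> and unit \<open>u\<close> of the bialgebra
  modality are parameters.\<close>

context
  fixes X :: "('o, 'a, 'z) coalgebra_modality_scheme" (structure)
begin

definition constant_rule :: "('o \<Rightarrow> 'a) \<Rightarrow> bool" where
  "constant_rule \<eta> \<longleftrightarrow> (\<forall>A\<in>Obj X. \<eta> A \<Zsemi> \<^bold>e A = \<^bold>0 A \<^bold>K)"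

definition product_rule :: "('o \<Rightarrow> 'a) \<Rightarrow> ('o \<Rightarrow> 'a) \<Rightarrow> bool" where
  "product_rule u \<eta> \<longleftrightarrow> (\<forall>A\<in>Obj X. \<eta> A \<Zsemi> \<Delta> A = \<eta> A \<otimes> u A \<oplus> u A \<otimes> \<eta> A)"

definition linear_rule :: "('o \<Rightarrow> 'a) \<Rightarrow> bool" where
  "linear_rule \<eta> \<longleftrightarrow> (\<forall>A\<in>Obj X. \<eta> A \<Zsemi> \<epsilon> A = \<^bold>1 A)"

definition chain_rule :: "('o \<Rightarrow> 'a) \<Rightarrow> ('o \<Rightarrow> 'a) \<Rightarrow> bool" where
  "chain_rule mu \<eta> \<longleftrightarrow> (\<forall>A\<in>Obj X.
     (\<^bold>1 (\<^bold>!\<^sub>o A) \<otimes> \<eta> A) \<Zsemi> mu A \<Zsemi> \<delta> A =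
     (\<Delta> A \<otimes> \<eta> A) \<Zsemi> (\<^bold>1 (\<^bold>!\<^sub>o A) \<otimes> mu A) \<Zsemi> (\<delta> A \<otimes> \<eta> (\<^bold>!\<^sub>o A)) \<Zsemi> mu (\<^bold>!\<^sub>o A))"

definition alternative_chain_rule :: "('o \<Rightarrow> 'a) \<Rightarrow> ('o \<Rightarrow> 'a) \<Rightarrow> ('o \<Rightarrow> 'a) \<Rightarrow> bool" where
  "alternative_chain_rule mu u \<eta> \<longleftrightarrow> (\<forall>A\<in>Obj X.
     \<eta> A \<Zsemi> \<delta> A = (u A \<otimes> \<eta> A) \<Zsemi> (\<delta> A \<otimes> \<eta> (\<^bold>!\<^sub>o A)) \<Zsemi> mu (\<^bold>!\<^sub>o A))"

definition codereliction :: "('o \<Rightarrow> 'a) \<Rightarrow> ('o \<Rightarrow> 'a) \<Rightarrow> ('o \<Rightarrow> 'a) \<Rightarrow> bool" where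
  "codereliction mu u \<eta> \<longleftrightarrow>
     natural_transformation X (\<lambda>A. A) (\<lambda>f. f) \<^bold>!\<^sub>o \<^bold>! \<eta> \<and>
     constant_rule \<eta> \<and> product_rule u \<eta> \<and> linear_rule \<eta> \<and> chain_rule mu \<eta>"

end

definition monoidal_rule ::
    "('o, 'a, 'z) monoidal_coalgebra_modality_scheme \<Rightarrow> ('o \<Rightarrow> 'a) \<Rightarrow> bool" where
  "monoidal_rule X \<eta> \<longleftrightarrow> (\<forall>A\<in>Obj X. \<forall>B\<in>Obj X.
     (\<^bold>1\<^bsub>X\<^esub> (\<^bold>!\<^sub>o\<^bsub>X\<^esub> A) \<otimes>\<^bsub>X\<^esub> \<eta> B) \<Zsemi>\<^bsub>X\<^esub> \<^bold>m\<^bsub>X\<^esub> A B =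
     (\<epsilon>\<^bsub>X\<^esub> A \<otimes>\<^bsub>X\<^esub> \<^bold>1\<^bsub>X\<^esub> B) \<Zsemi>\<^bsub>X\<^esub> \<eta> (A \<otimes>\<^sub>o\<^bsub>X\<^esub> B))"

end

theory Submission
  imports Defs
begin

text \<open>
  A \<open>!\<close>-coalgebra map into the cofree coalgebra \<open>!A\<close> is determined by its composite with \<open>\<epsilon>\<close>, and
  \<open>\<nabla>\<close>, \<open>u\<close> and \<open>m\<close> are the coalgebra maps induced by \<open>\<epsilon> \<otimes> e + e \<otimes> \<epsilon>\<close>, \<open>0\<close> and \<open>\<epsilon> \<otimes> \<epsilon>\<close>; this
  gives all the identities between them.  The constant rule is the naturality of \<open>\<eta>\<close> at \<open>0\<close>.
  For the product rule and the monoidal rule, objects \<open>!A \<otimes> !B\<close> replace the missing biproducts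
  \<open>A \<oplus> B\<close>.  Conversely, the chain rule follows from the alternative one because
  \<open>\<nabla> \<delta> = (\<delta> \<otimes> \<delta>) m !\<nabla>\<close> and \<open>m\<close> distributes over \<open>\<nabla>\<close>.
\<close>

text \<open>The chain rule speaks of \<nabla> and the monoidal rule of \<open>m\<close>. With
  biproducts they would be compared through the Seely isomorphism between \<open>!\<close> of a
  biproduct and a tensor of \<open>!\<close>s. Here \<eta> itself supplies a substitute:
  \<open>\<eta> \<otimes> u\<close> and \<open>u \<otimes> \<eta>\<close> map \<open>A\<close> and
  \<open>B\<close> into \<open>S = !A \<otimes> !B\<close>, with retractions
  \<open>\<epsilon> \<otimes> e\<close> and \<open>e \<otimes> \<epsilon>\<close> by the linear
  rule; the mixed composites vanish since both \<open>\<eta>\<close> followed by \<open>e\<close>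
  and \<open>u\<close> followed by \<epsilon> are zero. Hence \<open>S\<close> is a retract of
  \<open>!S\<close>, and this half of a Seely isomorphism suffices to write \<open>m\<close> in
  terms of \<nabla>. That \<open>m\<close> distributes over \<nabla> means
  \<open>m(x, y z) = m(x1, y) m(x2, z)\<close>, where \<Delta> splits \<open>x\<close> into
  \<open>x1\<close> and \<open>x2\<close>.\<close>

subsection \<open>Strict monoidal categories\<close>

text \<open>Outside \<open>arr\<close> the values of \<open>src\<close> and \<open>tgt\<close> are arbitrary.\<close>

context category
begin

definition arr :: "'a \<Rightarrow> bool" where
  "arr f \<longleftrightarrow> (\<exists>A B. f \<in> Hom X A B)"

definition src :: "'a \<Rightarrow> 'o" where
  "src f = (THE A. \<exists>B. f \<in> Hom X A B)"

definition tgt :: "'a \<Rightarrow> 'o" where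
  "tgt f = (THE B. \<exists>A. f \<in> Hom X A B)"

lemma Hom_arrD:
  assumes "f \<in> Hom X A B"
  shows "arr f" and "src f = A" and "tgt f = B"
  using assms Hom_disjoint[of f] unfolding arr_def src_def tgt_def by blast+

text \<open>\<open>Hom_disjoint\<close> makes \<open>src\<close> and \<open>tgt\<close> well defined
  on arrows, so typing conditions turn into equations between objects that the simplifier can
  discharge. The primed copies of the axioms below have this form for that reason.\<close>

lemma in_Hom_iff: "f \<in> Hom X A B \<longleftrightarrow> arr f \<and> src f = A \<and> tgt f = B"
  using Hom_arrD arr_def by metis

lemma arr_in_Hom: "arr f \<Longrightarrow> f \<in> Hom X (src f) (tgt f)"
  by (simp add: in_Hom_iff)

lemma src_tgt_Obj [simp]:
  assumes "arr f"
  shows "src f \<in> Obj X" and "tgt f \<in> Obj X"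
  using Hom_Obj[OF arr_in_Hom[OF assms]] by auto

lemma arr_ident [simp]:
  assumes "A \<in> Obj X"
  shows "arr (\<^bold>1 A)" and "src (\<^bold>1 A) = A" and "tgt (\<^bold>1 A) = A"
  using ident_Hom[OF assms] by (auto simp: in_Hom_iff)

lemma arr_seq [simp]:
  assumes "arr f" and "arr g" and "tgt f = src g"
  shows "arr (f \<Zsemi> g)" and "src (f \<Zsemi> g) = src f" and "tgt (f \<Zsemi> g) = tgt g"
  using seq_Hom[of f "src f" "tgt f" g "tgt g"] assms by (auto simp: in_Hom_iff)

lemma ident_seq' [simp]: "arr f \<Longrightarrow> src f = A \<Longrightarrow> \<^bold>1 A \<Zsemi> f = f"
  and seq_ident' [simp]: "arr f \<Longrightarrow> tgt f = A \<Longrightarrow> f \<Zsemi> \<^bold>1 A = f"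
  by (auto intro: ident_seq seq_ident simp: in_Hom_iff)

lemma seq_assoc':
  "arr f \<Longrightarrow> arr g \<Longrightarrow> arr h \<Longrightarrow> tgt f = src g \<Longrightarrow> tgt g = src h
    \<Longrightarrow> (f \<Zsemi> g) \<Zsemi> h = f \<Zsemi> (g \<Zsemi> h)"
  by (auto intro!: seq_assoc simp: in_Hom_iff)

end

section \<open>Tensor, interchange and symmetry\<close>

context sym_mon_category
begin

declare unit_Obj [simp] tensor_Obj [simp] tensor_obj_assoc [simp] unit_tensor_obj [simp]
  tensor_obj_unit [simp] tensor_ident [simp]

lemma arr_tensor [simp]:
  assumes "arr f" and "arr g"
  shows "arr (f \<otimes> g)" and "src (f \<otimes> g) = src f \<otimes>\<^sub>o src g" and "tgt (f \<otimes> g) = tgt f \<otimes>\<^sub>o tgt g"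
  using tensor_Hom[OF arr_in_Hom[OF assms(1)] arr_in_Hom[OF assms(2)]] by (auto simp: in_Hom_iff)

lemma tensor_assoc' [simp]:
  "arr f \<Longrightarrow> arr g \<Longrightarrow> arr h \<Longrightarrow> (f \<otimes> g) \<otimes> h = f \<otimes> (g \<otimes> h)"
  by (auto intro!: tensor_assoc dest: arr_in_Hom)

lemma unit_tensor' [simp]: "arr f \<Longrightarrow> \<^bold>1 \<^bold>K \<otimes> f = f"
  and tensor_unit' [simp]: "arr f \<Longrightarrow> f \<otimes> \<^bold>1 \<^bold>K = f"
  by (auto intro!: unit_tensor tensor_unit dest: arr_in_Hom)

text \<open>Interchange is oriented so that rewriting merges composites of tensors. It needs
  matching bracketings and visible identity factors, hence the frequent removal of
  \<open>tensor_assoc'\<close>, \<open>unit_tensor'\<close> or \<open>tensor_unit'\<close> from the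
  simpset where it is used.\<close>

lemma seq_tensor:
  "arr f \<Longrightarrow> arr g \<Longrightarrow> arr h \<Longrightarrow> arr k \<Longrightarrow> tgt f = src g \<Longrightarrow> tgt h = src k
    \<Longrightarrow> (f \<otimes> h) \<Zsemi> (g \<otimes> k) = (f \<Zsemi> g) \<otimes> (h \<Zsemi> k)"
  by (rule interchange[symmetric]) (auto simp: in_Hom_iff)

lemma arr_symmetry [simp]:
  assumes "A \<in> Obj X" and "B \<in> Obj X"
  shows "arr (\<sigma> A B)" and "src (\<sigma> A B) = A \<otimes>\<^sub>o B" and "tgt (\<sigma> A B) = B \<otimes>\<^sub>o A"
  using symmetry_Hom[OF assms] by (auto simp: in_Hom_iff)

lemma symmetry_natural':
  "arr f \<Longrightarrow> arr g \<Longrightarrow> tgt f = B \<Longrightarrow> tgt g = D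
    \<Longrightarrow> (f \<otimes> g) \<Zsemi> \<sigma> B D = \<sigma> (src f) (src g) \<Zsemi> (g \<otimes> f)"
  by (rule symmetry_natural) (auto simp: in_Hom_iff)

text \<open>The hexagon with both other objects equal to the unit makes this symmetry idempotent,
  and an invertible idempotent is an identity.\<close>

lemma symmetry_unit_right [simp]:
  assumes "A \<in> Obj X"
  shows "\<sigma> A \<^bold>K = \<^bold>1 A"
proof -
  let ?s = "\<sigma> A \<^bold>K"
  have s: "?s = ?s \<Zsemi> ?s"
    using hexagon[OF assms unit_Obj unit_Obj] assms by simp
  have "?s \<Zsemi> \<sigma> \<^bold>K A = \<^bold>1 A"
    using symmetry_inverse[OF assms unit_Obj] assms by simp
  then have "?s \<Zsemi> (?s \<Zsemi> \<sigma> \<^bold>K A) = ?s"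
    using assms by simp
  moreover have "?s \<Zsemi> (?s \<Zsemi> \<sigma> \<^bold>K A) = (?s \<Zsemi> ?s) \<Zsemi> \<sigma> \<^bold>K A"
    using assms by (simp add: seq_assoc')
  ultimately show ?thesis
    using s \<open>?s \<Zsemi> \<sigma> \<^bold>K A = \<^bold>1 A\<close> by simp
qed

lemma symmetry_unit_left [simp]: "A \<in> Obj X \<Longrightarrow> \<sigma> \<^bold>K A = \<^bold>1 A"
  using symmetry_inverse[of A "\<^bold>K"] by simp

text \<open>The exchange that makes the tensor product of two comonoids a comonoid, as in
  \<open>m_dupl\<close>. It is an identity as soon as one of the two exchanged objects is the unit,
  which later computations exploit.\<close>

definition middle :: "'o \<Rightarrow> 'o \<Rightarrow> 'o \<Rightarrow> 'o \<Rightarrow> 'a" where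
  "middle A B C D = \<^bold>1 A \<otimes> \<sigma> B C \<otimes> \<^bold>1 D"

lemma arr_middle [simp]:
  assumes "A \<in> Obj X" "B \<in> Obj X" "C \<in> Obj X" "D \<in> Obj X"
  shows "arr (middle A B C D)" and "src (middle A B C D) = A \<otimes>\<^sub>o B \<otimes>\<^sub>o C \<otimes>\<^sub>o D"
    and "tgt (middle A B C D) = A \<otimes>\<^sub>o C \<otimes>\<^sub>o B \<otimes>\<^sub>o D"
  using assms by (auto simp: middle_def)

lemma middle_natural:
  assumes "arr f" "arr g" "arr h" "arr k"
  shows "middle (src f) (src g) (src h) (src k) \<Zsemi> (f \<otimes> h \<otimes> g \<otimes> k)
    = (f \<otimes> g \<otimes> h \<otimes> k) \<Zsemi> middle (tgt f) (tgt g) (tgt h) (tgt k)"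
proof -
  have "(\<^bold>1 (src f) \<otimes> \<sigma> (src g) (src h) \<otimes> \<^bold>1 (src k)) \<Zsemi> (f \<otimes> (h \<otimes> g) \<otimes> k)
      = f \<otimes> (\<sigma> (src g) (src h) \<Zsemi> (h \<otimes> g)) \<otimes> k"
    using assms by (simp add: seq_tensor del: tensor_assoc')
  also have "\<dots> = f \<otimes> ((g \<otimes> h) \<Zsemi> \<sigma> (tgt g) (tgt h)) \<otimes> k"
    using assms by (simp add: symmetry_natural' del: tensor_assoc')
  also have "\<dots> = (f \<otimes> (g \<otimes> h) \<otimes> k) \<Zsemi> (\<^bold>1 (tgt f) \<otimes> \<sigma> (tgt g) (tgt h) \<otimes> \<^bold>1 (tgt k))"
    using assms by (simp add: seq_tensor del: tensor_assoc')
  finally show ?thesis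
    using assms by (simp add: middle_def)
qed

end

section \<open>Enrichment in commutative monoids\<close>

context additive_sym_mon_category
begin

lemma arr_zero [simp]:
  assumes "A \<in> Obj X" and "B \<in> Obj X"
  shows "arr (\<^bold>0 A B)" and "src (\<^bold>0 A B) = A" and "tgt (\<^bold>0 A B) = B"
  using zero_Hom[OF assms] by (auto simp: in_Hom_iff)

lemma arr_add [simp]:
  assumes "arr f" and "arr g" and "src f = src g" and "tgt f = tgt g"
  shows "arr (f \<oplus> g)" and "src (f \<oplus> g) = src g" and "tgt (f \<oplus> g) = tgt g"
  using add_Hom[of f "src g" "tgt g" g] assms by (auto simp: in_Hom_iff)

lemma zero_add' [simp]: "arr f \<Longrightarrow> A = src f \<Longrightarrow> B = tgt f \<Longrightarrow> \<^bold>0 A B \<oplus> f = f"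
  by (auto intro: zero_add arr_in_Hom)

lemma add_zero' [simp]: "arr f \<Longrightarrow> A = src f \<Longrightarrow> B = tgt f \<Longrightarrow> f \<oplus> \<^bold>0 A B = f"
  using add_commute[of f A B "\<^bold>0 A B"] by (simp add: in_Hom_iff)

lemma add_seq:
  "arr f \<Longrightarrow> arr g \<Longrightarrow> arr h \<Longrightarrow> src f = src g \<Longrightarrow> tgt f = tgt g \<Longrightarrow> tgt g = src h
    \<Longrightarrow> (f \<oplus> g) \<Zsemi> h = f \<Zsemi> h \<oplus> g \<Zsemi> h"
  by (rule seq_add_left) (auto simp: in_Hom_iff)

lemma seq_add:
  "arr f \<Longrightarrow> arr g \<Longrightarrow> arr h \<Longrightarrow> src g = src h \<Longrightarrow> tgt g = tgt h \<Longrightarrow> tgt f = src h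
    \<Longrightarrow> f \<Zsemi> (g \<oplus> h) = f \<Zsemi> g \<oplus> f \<Zsemi> h"
  by (rule seq_add_right) (auto simp: in_Hom_iff)

lemma zero_seq' [simp]:
  "A \<in> Obj X \<Longrightarrow> arr f \<Longrightarrow> src f = B \<Longrightarrow> \<^bold>0 A B \<Zsemi> f = \<^bold>0 A (tgt f)"
  by (rule zero_seq) (auto simp: in_Hom_iff)

lemma seq_zero' [simp]:
  "C \<in> Obj X \<Longrightarrow> arr f \<Longrightarrow> tgt f = B \<Longrightarrow> f \<Zsemi> \<^bold>0 B C = \<^bold>0 (src f) C"
  by (rule seq_zero) (auto simp: in_Hom_iff)

lemma tensor_add:
  "arr f \<Longrightarrow> arr g \<Longrightarrow> arr h \<Longrightarrow> src g = src h \<Longrightarrow> tgt g = tgt h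
    \<Longrightarrow> f \<otimes> (g \<oplus> h) = f \<otimes> g \<oplus> f \<otimes> h"
  by (rule tensor_add_right) (auto simp: in_Hom_iff)

lemma zero_tensor' [simp]:
  "A \<in> Obj X \<Longrightarrow> B \<in> Obj X \<Longrightarrow> arr f
    \<Longrightarrow> \<^bold>0 A B \<otimes> f = \<^bold>0 (A \<otimes>\<^sub>o src f) (B \<otimes>\<^sub>o tgt f)"
  by (rule zero_tensor) (auto simp: in_Hom_iff)

lemma tensor_zero' [simp]:
  "A \<in> Obj X \<Longrightarrow> B \<in> Obj X \<Longrightarrow> arr f
    \<Longrightarrow> f \<otimes> \<^bold>0 A B = \<^bold>0 (src f \<otimes>\<^sub>o A) (tgt f \<otimes>\<^sub>o B)"
  by (rule tensor_zero) (auto simp: in_Hom_iff)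

end

section \<open>The comonad and its natural comonoids\<close>

context coalgebra_modality
begin

lemma bang_Obj [simp]: "A \<in> Obj X \<Longrightarrow> \<^bold>!\<^sub>o A \<in> Obj X"
  using bang_functor by (simp add: endofunctor_def)

lemma arr_bang [simp]:
  assumes "arr f"
  shows "arr (\<^bold>! f)" and "src (\<^bold>! f) = \<^bold>!\<^sub>o (src f)" and "tgt (\<^bold>! f) = \<^bold>!\<^sub>o (tgt f)"
  using bang_functor arr_in_Hom[OF assms] by (auto simp: endofunctor_def in_Hom_iff)

lemma bang_ident [simp]: "A \<in> Obj X \<Longrightarrow> \<^bold>! (\<^bold>1 A) = \<^bold>1 (\<^bold>!\<^sub>o A)"
  using bang_functor by (simp add: endofunctor_def)

lemma bang_seq:
  "arr f \<Longrightarrow> arr g \<Longrightarrow> tgt f = src g \<Longrightarrow> \<^bold>! (f \<Zsemi> g) = \<^bold>! f \<Zsemi> \<^bold>! g"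
  using bang_functor arr_in_Hom[of f] arr_in_Hom[of g] by (auto simp: endofunctor_def)

lemma arr_modality [simp]:
  assumes "A \<in> Obj X"
  shows "arr (\<delta> A)" and "src (\<delta> A) = \<^bold>!\<^sub>o A" and "tgt (\<delta> A) = \<^bold>!\<^sub>o (\<^bold>!\<^sub>o A)"
    and "arr (\<epsilon> A)" and "src (\<epsilon> A) = \<^bold>!\<^sub>o A" and "tgt (\<epsilon> A) = A"
    and "arr (\<Delta> A)" and "src (\<Delta> A) = \<^bold>!\<^sub>o A" and "tgt (\<Delta> A) = \<^bold>!\<^sub>o A \<otimes>\<^sub>o \<^bold>!\<^sub>o A"
    and "arr (\<^bold>e A)" and "src (\<^bold>e A) = \<^bold>!\<^sub>o A" and "tgt (\<^bold>e A) = \<^bold>K"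
  using comult_natural counit_natural dupl_natural disc_natural assms
  by (auto simp: natural_transformation_def in_Hom_iff)

lemma bang_comult: "arr f \<Longrightarrow> tgt f = B \<Longrightarrow> \<^bold>! f \<Zsemi> \<delta> B = \<delta> (src f) \<Zsemi> \<^bold>! (\<^bold>! f)"
  and bang_counit: "arr f \<Longrightarrow> tgt f = B \<Longrightarrow> \<^bold>! f \<Zsemi> \<epsilon> B = \<epsilon> (src f) \<Zsemi> f"
  and bang_dupl: "arr f \<Longrightarrow> tgt f = B \<Longrightarrow> \<^bold>! f \<Zsemi> \<Delta> B = \<Delta> (src f) \<Zsemi> (\<^bold>! f \<otimes> \<^bold>! f)"
  using comult_natural counit_natural dupl_natural
  by (auto simp: natural_transformation_def in_Hom_iff)

lemma bang_disc: "arr f \<Longrightarrow> tgt f = B \<Longrightarrow> \<^bold>! f \<Zsemi> \<^bold>e B = \<^bold>e (src f)"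
proof -
  assume "arr f" "tgt f = B"
  then have "\<^bold>! f \<Zsemi> \<^bold>e B = \<^bold>e (src f) \<Zsemi> \<^bold>1 \<^bold>K"
    using disc_natural arr_in_Hom[of f] unfolding natural_transformation_def by metis
  then show ?thesis
    using \<open>arr f\<close> by simp
qed

end

subsection \<open>Coalgebras of the modality\<close>

context additive_linear_category
begin

lemma arr_m [simp]:
  assumes "A \<in> Obj X" and "B \<in> Obj X"
  shows "arr (\<^bold>m A B)" and "src (\<^bold>m A B) = \<^bold>!\<^sub>o A \<otimes>\<^sub>o \<^bold>!\<^sub>o B" and "tgt (\<^bold>m A B) = \<^bold>!\<^sub>o (A \<otimes>\<^sub>o B)"
  using m_Hom[OF assms] by (auto simp: in_Hom_iff)

lemma arr_mK [simp]: "arr \<^bold>m\<^sub>K" "src \<^bold>m\<^sub>K = \<^bold>K" "tgt \<^bold>m\<^sub>K = \<^bold>!\<^sub>o \<^bold>K"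
  using mK_Hom by (auto simp: in_Hom_iff)

lemma bang_m:
  "arr f \<Longrightarrow> arr g \<Longrightarrow> tgt f = B \<Longrightarrow> tgt g = D
    \<Longrightarrow> (\<^bold>! f \<otimes> \<^bold>! g) \<Zsemi> \<^bold>m B D = \<^bold>m (src f) (src g) \<Zsemi> \<^bold>! (f \<otimes> g)"
  by (rule m_natural) (auto simp: in_Hom_iff)

text \<open>Eilenberg-Moore coalgebras of the comonad; the structure map alone represents the
  coalgebra, its carrier being \<open>src c\<close>.\<close>

definition coalg :: "'a \<Rightarrow> bool" where
  "coalg c \<longleftrightarrow> arr c \<and> tgt c = \<^bold>!\<^sub>o (src c) \<and>
    c \<Zsemi> \<epsilon> (src c) = \<^bold>1 (src c) \<and> c \<Zsemi> \<delta> (src c) = c \<Zsemi> \<^bold>! c"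

text \<open>The structure map of the tensor product of two coalgebras, which exists because the
  comonad is monoidal.\<close>

definition tens :: "'a \<Rightarrow> 'a \<Rightarrow> 'a" where
  "tens c d = (c \<otimes> d) \<Zsemi> \<^bold>m (src c) (src d)"

definition coalg_mor :: "'a \<Rightarrow> 'a \<Rightarrow> 'a \<Rightarrow> bool" where
  "coalg_mor c d h \<longleftrightarrow> coalg c \<and> coalg d \<and> arr h \<and> src h = src c \<and> tgt h = src d \<and>
    h \<Zsemi> d = c \<Zsemi> \<^bold>! h"

lemma coalgD [simp]: "coalg c \<Longrightarrow> arr c" "coalg c \<Longrightarrow> tgt c = \<^bold>!\<^sub>o (src c)"
  by (auto simp only: coalg_def)

lemma coalg_counit: "coalg c \<Longrightarrow> c \<Zsemi> \<epsilon> (src c) = \<^bold>1 (src c)"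
  and coalg_coassoc: "coalg c \<Longrightarrow> c \<Zsemi> \<delta> (src c) = c \<Zsemi> \<^bold>! c"
  by (auto simp only: coalg_def)

lemma coalgI:
  "arr c \<Longrightarrow> tgt c = \<^bold>!\<^sub>o (src c) \<Longrightarrow> c \<Zsemi> \<epsilon> (src c) = \<^bold>1 (src c)
    \<Longrightarrow> c \<Zsemi> \<delta> (src c) = c \<Zsemi> \<^bold>! c \<Longrightarrow> coalg c"
  by (simp only: coalg_def)

lemma coalg_comult [simp]: "A \<in> Obj X \<Longrightarrow> coalg (\<delta> A)"
  by (rule coalgI) (simp_all add: comult_counit comult_comult)

lemma coalg_mK [simp]: "coalg \<^bold>m\<^sub>K"
  by (rule coalgI) (simp_all add: mK_counit mK_comult)

lemma arr_tens [simp]: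
  assumes "coalg c" and "coalg d"
  shows "arr (tens c d)" and "src (tens c d) = src c \<otimes>\<^sub>o src d"
    and "tgt (tens c d) = \<^bold>!\<^sub>o (src c \<otimes>\<^sub>o src d)"
  using assms by (auto simp: tens_def)

text \<open>The counit law comes from \<epsilon> being monoidal; coassociativity comes from \<delta>
  being monoidal together with naturality of \<open>m\<close>.\<close>

lemma coalg_tens [simp]:
  assumes c: "coalg c" and d: "coalg d"
  shows "coalg (tens c d)"
proof -
  let ?A = "src c" and ?B = "src d"
  have "tens c d \<Zsemi> \<epsilon> (?A \<otimes>\<^sub>o ?B) = (c \<otimes> d) \<Zsemi> (\<epsilon> ?A \<otimes> \<epsilon> ?B)"
    using c d by (simp add: tens_def seq_assoc' m_counit)
  also have "\<dots> = \<^bold>1 (?A \<otimes>\<^sub>o ?B)"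
    using c d by (simp add: seq_tensor coalg_counit)
  finally have counit: "tens c d \<Zsemi> \<epsilon> (?A \<otimes>\<^sub>o ?B) = \<^bold>1 (?A \<otimes>\<^sub>o ?B)" .
  have "tens c d \<Zsemi> \<delta> (?A \<otimes>\<^sub>o ?B)
      = (c \<otimes> d) \<Zsemi> ((\<delta> ?A \<otimes> \<delta> ?B) \<Zsemi> \<^bold>m (\<^bold>!\<^sub>o ?A) (\<^bold>!\<^sub>o ?B) \<Zsemi> \<^bold>! (\<^bold>m ?A ?B))"
    using c d by (simp add: tens_def seq_assoc' m_comult)
  also have "\<dots> = ((c \<otimes> d) \<Zsemi> (\<delta> ?A \<otimes> \<delta> ?B)) \<Zsemi> \<^bold>m (\<^bold>!\<^sub>o ?A) (\<^bold>!\<^sub>o ?B) \<Zsemi> \<^bold>! (\<^bold>m ?A ?B)"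
    using c d by (simp add: seq_assoc')
  also have "(c \<otimes> d) \<Zsemi> (\<delta> ?A \<otimes> \<delta> ?B) = (c \<Zsemi> \<^bold>! c) \<otimes> (d \<Zsemi> \<^bold>! d)"
    using c d by (simp add: seq_tensor coalg_coassoc)
  also have "\<dots> = (c \<otimes> d) \<Zsemi> (\<^bold>! c \<otimes> \<^bold>! d)"
    using c d by (simp add: seq_tensor)
  also have "\<dots> \<Zsemi> \<^bold>m (\<^bold>!\<^sub>o ?A) (\<^bold>!\<^sub>o ?B) \<Zsemi> \<^bold>! (\<^bold>m ?A ?B)
      = (c \<otimes> d) \<Zsemi> ((\<^bold>! c \<otimes> \<^bold>! d) \<Zsemi> \<^bold>m (\<^bold>!\<^sub>o ?A) (\<^bold>!\<^sub>o ?B)) \<Zsemi> \<^bold>! (\<^bold>m ?A ?B)"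
    using c d by (simp add: seq_assoc')
  also have "(\<^bold>! c \<otimes> \<^bold>! d) \<Zsemi> \<^bold>m (\<^bold>!\<^sub>o ?A) (\<^bold>!\<^sub>o ?B) = \<^bold>m ?A ?B \<Zsemi> \<^bold>! (c \<otimes> d)"
    using c d by (simp add: bang_m)
  also have "(c \<otimes> d) \<Zsemi> \<dots> \<Zsemi> \<^bold>! (\<^bold>m ?A ?B) = tens c d \<Zsemi> \<^bold>! (tens c d)"
    using c d by (simp add: seq_assoc' tens_def bang_seq)
  finally show ?thesis
    using c d counit by (intro coalgI) simp_all
qed

text \<open>Strictness of the base passes to coalgebras. As rewrite rules, this and
  \<open>tens_mK\<close> identify the differently bracketed or padded source coalgebras that arise
  when tensors of coalgebra maps are composed.\<close>

lemma tens_assoc [simp]: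
  assumes "coalg c" "coalg d" "coalg k"
  shows "tens (tens c d) k = tens c (tens d k)"
proof -
  let ?A = "src c" and ?B = "src d" and ?C = "src k"
  have "tens (tens c d) k
      = ((c \<otimes> d) \<otimes> k) \<Zsemi> ((\<^bold>m ?A ?B \<otimes> \<^bold>1 (\<^bold>!\<^sub>o ?C)) \<Zsemi> \<^bold>m (?A \<otimes>\<^sub>o ?B) ?C)"
    using assms by (simp add: tens_def seq_assoc'[symmetric] seq_tensor del: tensor_assoc')
  also have "\<dots> = (c \<otimes> (d \<otimes> k)) \<Zsemi> ((\<^bold>1 (\<^bold>!\<^sub>o ?A) \<otimes> \<^bold>m ?B ?C) \<Zsemi> \<^bold>m ?A (?B \<otimes>\<^sub>o ?C))"
    using assms by (simp add: m_assoc)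
  also have "\<dots> = tens c (tens d k)"
    using assms by (simp add: tens_def seq_assoc'[symmetric] seq_tensor del: tensor_assoc')
  finally show ?thesis .
qed

lemma tens_mK [simp]:
  assumes "coalg c"
  shows "tens \<^bold>m\<^sub>K c = c" and "tens c \<^bold>m\<^sub>K = c"
proof -
  have "tens \<^bold>m\<^sub>K c = (\<^bold>1 \<^bold>K \<otimes> c) \<Zsemi> ((\<^bold>m\<^sub>K \<otimes> \<^bold>1 (\<^bold>!\<^sub>o (src c))) \<Zsemi> \<^bold>m \<^bold>K (src c))"
    using assms by (simp add: tens_def seq_assoc'[symmetric] seq_tensor del: unit_tensor')
  then show "tens \<^bold>m\<^sub>K c = c"
    using assms by (simp add: m_unit_left)
  have "tens c \<^bold>m\<^sub>K = (c \<otimes> \<^bold>1 \<^bold>K) \<Zsemi> ((\<^bold>1 (\<^bold>!\<^sub>o (src c)) \<otimes> \<^bold>m\<^sub>K) \<Zsemi> \<^bold>m (src c) \<^bold>K)"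
    using assms by (simp add: tens_def seq_assoc'[symmetric] seq_tensor del: tensor_unit')
  then show "tens c \<^bold>m\<^sub>K = c"
    using assms by (simp add: m_unit_right)
qed

section \<open>Coalgebra morphisms and cofreeness\<close>

lemma coalg_mor_ident: "coalg c \<Longrightarrow> A = src c \<Longrightarrow> coalg_mor c c (\<^bold>1 A)"
  by (simp add: coalg_mor_def)

lemma coalg_mor_seq:
  assumes "coalg_mor c d h" and "coalg_mor d k g"
  shows "coalg_mor c k (h \<Zsemi> g)"
proof -
  have t: "arr h" "arr g" "coalg c" "coalg d" "coalg k"
    "src h = src c" "tgt h = src d" "src g = src d" "tgt g = src k"
    using assms by (auto simp: coalg_mor_def)
  have "(h \<Zsemi> g) \<Zsemi> k = h \<Zsemi> (d \<Zsemi> \<^bold>! g)"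
    using assms t by (simp add: seq_assoc' coalg_mor_def)
  also have "\<dots> = (c \<Zsemi> \<^bold>! h) \<Zsemi> \<^bold>! g"
    using assms(1) t by (simp add: seq_assoc'[symmetric] coalg_mor_def)
  finally show ?thesis
    using t by (simp add: coalg_mor_def seq_assoc' bang_seq)
qed

lemma coalg_mor_tensor:
  assumes "coalg_mor c d h" and "coalg_mor c' d' h'"
  shows "coalg_mor (tens c c') (tens d d') (h \<otimes> h')"
proof -
  have t: "arr h" "arr h'" "coalg c" "coalg d" "coalg c'" "coalg d'"
    "src h = src c" "tgt h = src d" "src h' = src c'" "tgt h' = src d'"
    and e: "h \<Zsemi> d = c \<Zsemi> \<^bold>! h" "h' \<Zsemi> d' = c' \<Zsemi> \<^bold>! h'"
    using assms by (auto simp: coalg_mor_def)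
  have "(h \<otimes> h') \<Zsemi> tens d d' = ((h \<Zsemi> d) \<otimes> (h' \<Zsemi> d')) \<Zsemi> \<^bold>m (src d) (src d')"
    using t by (simp add: tens_def seq_assoc'[symmetric] seq_tensor)
  also have "\<dots> = (c \<otimes> c') \<Zsemi> ((\<^bold>! h \<otimes> \<^bold>! h') \<Zsemi> \<^bold>m (src d) (src d'))"
    using t by (simp add: e seq_assoc'[symmetric] seq_tensor)
  also have "\<dots> = tens c c' \<Zsemi> \<^bold>! (h \<otimes> h')"
    using t by (simp add: tens_def seq_assoc' bang_m)
  finally show ?thesis
    using t by (simp add: coalg_mor_def)
qed

text \<open>The existence half of cofreeness: \<open>c\<close> followed by \<open>! f\<close> is the
  transpose of \<open>f\<close>, and \<open>promote_counit\<close> recovers \<open>f\<close> from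
  it.\<close>

lemma coalg_mor_promote:
  assumes c: "coalg c" and f: "arr f" "src f = src c" "tgt f = B"
  shows "coalg_mor c (\<delta> B) (c \<Zsemi> \<^bold>! f)"
proof -
  have B: "B \<in> Obj X"
    using f by auto
  have "(c \<Zsemi> \<^bold>! f) \<Zsemi> \<delta> B = (c \<Zsemi> \<delta> (src c)) \<Zsemi> \<^bold>! (\<^bold>! f)"
    using c f B by (simp add: seq_assoc' bang_comult)
  also have "c \<Zsemi> \<delta> (src c) = c \<Zsemi> \<^bold>! c"
    using c by (rule coalg_coassoc)
  finally have "(c \<Zsemi> \<^bold>! f) \<Zsemi> \<delta> B = c \<Zsemi> \<^bold>! (c \<Zsemi> \<^bold>! f)"
    using c f by (simp add: seq_assoc' bang_seq)
  then show ?thesis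
    using c f by (auto simp: coalg_mor_def)
qed

lemma promote_counit:
  assumes c: "coalg c" and f: "arr f" "src f = src c" "tgt f = B"
  shows "(c \<Zsemi> \<^bold>! f) \<Zsemi> \<epsilon> B = f"
proof -
  have "B \<in> Obj X"
    using f by auto
  then have "(c \<Zsemi> \<^bold>! f) \<Zsemi> \<epsilon> B = (c \<Zsemi> \<epsilon> (src c)) \<Zsemi> f"
    using c f by (simp add: seq_assoc' bang_counit)
  then show ?thesis
    using c f by (simp add: coalg_counit)
qed

text \<open>The uniqueness half: insert the triangle identity for \<delta> and \<open>!\<close> of
  \<epsilon> after \<open>h\<close>, then let \<open>h\<close> pass through \<delta> as a coalgebra
  map.\<close>

lemma coalg_mor_eq_promote:
  assumes h: "coalg_mor c (\<delta> A) h" and A: "A \<in> Obj X"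
  shows "h = c \<Zsemi> \<^bold>! (h \<Zsemi> \<epsilon> A)"
proof -
  have t: "arr h" "coalg c" "src h = src c" "tgt h = \<^bold>!\<^sub>o A" and e: "h \<Zsemi> \<delta> A = c \<Zsemi> \<^bold>! h"
    using h A by (auto simp: coalg_mor_def)
  have "h = h \<Zsemi> (\<delta> A \<Zsemi> \<^bold>! (\<epsilon> A))"
    using t A by (simp add: comult_bang_counit)
  also have "\<dots> = (c \<Zsemi> \<^bold>! h) \<Zsemi> \<^bold>! (\<epsilon> A)"
    using t A by (simp add: e[symmetric] seq_assoc')
  finally show ?thesis
    using t A by (simp add: seq_assoc' bang_seq)
qed

lemma coalg_mor_unique:
  assumes "coalg_mor c (\<delta> A) h" "coalg_mor c (\<delta> A) k" "A \<in> Obj X" "h \<Zsemi> \<epsilon> A = k \<Zsemi> \<epsilon> A"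
  shows "h = k"
  using coalg_mor_eq_promote[OF assms(1,3)] coalg_mor_eq_promote[OF assms(2,3)] assms(4) by simp

section \<open>The structure maps as coalgebra morphisms\<close>

lemma coalg_mor_dupl: "A \<in> Obj X \<Longrightarrow> coalg_mor (\<delta> A) (tens (\<delta> A) (\<delta> A)) (\<Delta> A)"
  by (simp add: coalg_mor_def) (simp add: tens_def comult_bang_dupl seq_assoc')

lemma coalg_mor_m:
  "A \<in> Obj X \<Longrightarrow> B \<in> Obj X \<Longrightarrow> coalg_mor (tens (\<delta> A) (\<delta> B)) (\<delta> (A \<otimes>\<^sub>o B)) (\<^bold>m A B)"
  by (simp add: coalg_mor_def) (simp add: tens_def m_comult)

lemma coalg_mor_symmetry:
  assumes "coalg c" "coalg d" "A = src c" "B = src d"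
  shows "coalg_mor (tens c d) (tens d c) (\<sigma> A B)"
proof -
  have "\<sigma> A B \<Zsemi> tens d c = (\<sigma> A B \<Zsemi> (d \<otimes> c)) \<Zsemi> \<^bold>m B A"
    using assms by (simp add: tens_def seq_assoc')
  also have "\<dots> = (c \<otimes> d) \<Zsemi> (\<sigma> (\<^bold>!\<^sub>o A) (\<^bold>!\<^sub>o B) \<Zsemi> \<^bold>m B A)"
    using assms symmetry_natural'[of c d "\<^bold>!\<^sub>o A" "\<^bold>!\<^sub>o B"] by (simp add: seq_assoc'[symmetric])
  also have "\<dots> = tens c d \<Zsemi> \<^bold>! (\<sigma> A B)"
    using assms by (simp add: tens_def seq_assoc' m_symmetry[symmetric])
  finally show ?thesis
    using assms by (simp add: coalg_mor_def)
qed

text \<open>With the two inner factors bracketed together, the exchange is a tensor of identities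
  and a symmetry; \<open>tens_assoc\<close> then removes the brackets.\<close>

lemma coalg_mor_middle:
  assumes "coalg a" "coalg b" "coalg c" "coalg d"
  shows "coalg_mor (tens a (tens b (tens c d))) (tens a (tens c (tens b d)))
    (middle (src a) (src b) (src c) (src d))"
proof -
  have "coalg_mor (tens a (tens (tens b c) d)) (tens a (tens (tens c b) d))
      (middle (src a) (src b) (src c) (src d))"
    unfolding middle_def
    by (intro coalg_mor_tensor coalg_mor_ident coalg_mor_symmetry assms refl)
  then show ?thesis
    using assms by simp
qed

lemma coalg_mor_bang:
  "arr f \<Longrightarrow> src f = A \<Longrightarrow> tgt f = B \<Longrightarrow> coalg_mor (\<delta> A) (\<delta> B) (\<^bold>! f)"
  by (auto simp: coalg_mor_def bang_comult)

subsection \<open>The induced bialgebra structure\<close>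

abbreviation sum_counit :: "'o \<Rightarrow> 'a" where
  "sum_counit A \<equiv> \<epsilon> A \<otimes> \<^bold>e A \<oplus> \<^bold>e A \<otimes> \<epsilon> A"

lemma mult_promote: "A \<in> Obj X \<Longrightarrow> \<nabla> A = tens (\<delta> A) (\<delta> A) \<Zsemi> \<^bold>! (sum_counit A)"
  by (simp add: ind_mult_def tens_def)

lemma coalg_mor_mult: "A \<in> Obj X \<Longrightarrow> coalg_mor (tens (\<delta> A) (\<delta> A)) (\<delta> A) (\<nabla> A)"
  by (simp add: mult_promote coalg_mor_promote)

lemma arr_mult [simp]:
  assumes "A \<in> Obj X"
  shows "arr (\<nabla> A)" and "src (\<nabla> A) = \<^bold>!\<^sub>o A \<otimes>\<^sub>o \<^bold>!\<^sub>o A" and "tgt (\<nabla> A) = \<^bold>!\<^sub>o A"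
  using assms by (auto simp: mult_promote)

lemma mult_counit: "A \<in> Obj X \<Longrightarrow> \<nabla> A \<Zsemi> \<epsilon> A = sum_counit A"
  by (simp add: mult_promote promote_counit)

lemma unit_promote: "\<^bold>u A = \<^bold>m\<^sub>K \<Zsemi> \<^bold>! (\<^bold>0 \<^bold>K A)"
  by (simp add: ind_unit_def)

lemma coalg_mor_unit: "A \<in> Obj X \<Longrightarrow> coalg_mor \<^bold>m\<^sub>K (\<delta> A) (\<^bold>u A)"
  by (simp add: unit_promote coalg_mor_promote)

lemma arr_unit [simp]:
  assumes "A \<in> Obj X"
  shows "arr (\<^bold>u A)" and "src (\<^bold>u A) = \<^bold>K" and "tgt (\<^bold>u A) = \<^bold>!\<^sub>o A"
  using assms by (auto simp: unit_promote)

lemma unit_counit: "A \<in> Obj X \<Longrightarrow> \<^bold>u A \<Zsemi> \<epsilon> A = \<^bold>0 \<^bold>K A"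
  by (simp add: unit_promote promote_counit)

lemma unit_disc: "A \<in> Obj X \<Longrightarrow> \<^bold>u A \<Zsemi> \<^bold>e A = \<^bold>1 \<^bold>K"
  by (simp add: unit_promote seq_assoc' bang_disc mK_disc)

lemma unit_dupl:
  assumes "A \<in> Obj X"
  shows "\<^bold>u A \<Zsemi> \<Delta> A = \<^bold>u A \<otimes> \<^bold>u A"
proof -
  have "\<^bold>u A \<Zsemi> \<Delta> A = (\<^bold>m\<^sub>K \<Zsemi> \<Delta> \<^bold>K) \<Zsemi> (\<^bold>! (\<^bold>0 \<^bold>K A) \<otimes> \<^bold>! (\<^bold>0 \<^bold>K A))"
    using assms by (simp add: unit_promote seq_assoc' bang_dupl)
  then show ?thesis
    using assms by (simp add: mK_dupl unit_promote seq_tensor)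
qed

text \<open>Compare after \<epsilon>: \<open>u\<close> followed by \<epsilon> is zero and
  \<open>u\<close> followed by \<open>e\<close> is the identity, so one summand of
  \<open>sum_counit\<close> dies and the other leaves \<epsilon>. The source coalgebra, a tensor
  with \<open>m\<^sub>K\<close>, is \<delta> by \<open>tens_mK\<close>.\<close>

lemma unit_mult:
  assumes "A \<in> Obj X"
  shows "(\<^bold>u A \<otimes> \<^bold>1 (\<^bold>!\<^sub>o A)) \<Zsemi> \<nabla> A = \<^bold>1 (\<^bold>!\<^sub>o A)"
proof (rule coalg_mor_unique[OF _ _ assms])
  have "coalg_mor (tens \<^bold>m\<^sub>K (\<delta> A)) (\<delta> A) ((\<^bold>u A \<otimes> \<^bold>1 (\<^bold>!\<^sub>o A)) \<Zsemi> \<nabla> A)"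
    using assms
    by (intro coalg_mor_seq[OF _ coalg_mor_mult] coalg_mor_tensor coalg_mor_unit coalg_mor_ident) auto
  then show "coalg_mor (\<delta> A) (\<delta> A) ((\<^bold>u A \<otimes> \<^bold>1 (\<^bold>!\<^sub>o A)) \<Zsemi> \<nabla> A)"
    using assms by simp
  show "coalg_mor (\<delta> A) (\<delta> A) (\<^bold>1 (\<^bold>!\<^sub>o A))"
    using assms by (simp add: coalg_mor_ident)
  have "((\<^bold>u A \<otimes> \<^bold>1 (\<^bold>!\<^sub>o A)) \<Zsemi> \<nabla> A) \<Zsemi> \<epsilon> A = \<epsilon> A"
    using assms by (simp add: seq_assoc' mult_counit seq_add seq_tensor unit_counit unit_disc)
  then show "((\<^bold>u A \<otimes> \<^bold>1 (\<^bold>!\<^sub>o A)) \<Zsemi> \<nabla> A) \<Zsemi> \<epsilon> A = \<^bold>1 (\<^bold>!\<^sub>o A) \<Zsemi> \<epsilon> A"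
    using assms by simp
qed

lemma mult_unit:
  assumes "A \<in> Obj X"
  shows "(\<^bold>1 (\<^bold>!\<^sub>o A) \<otimes> \<^bold>u A) \<Zsemi> \<nabla> A = \<^bold>1 (\<^bold>!\<^sub>o A)"
proof (rule coalg_mor_unique[OF _ _ assms])
  have "coalg_mor (tens (\<delta> A) \<^bold>m\<^sub>K) (\<delta> A) ((\<^bold>1 (\<^bold>!\<^sub>o A) \<otimes> \<^bold>u A) \<Zsemi> \<nabla> A)"
    using assms
    by (intro coalg_mor_seq[OF _ coalg_mor_mult] coalg_mor_tensor coalg_mor_unit coalg_mor_ident) auto
  then show "coalg_mor (\<delta> A) (\<delta> A) ((\<^bold>1 (\<^bold>!\<^sub>o A) \<otimes> \<^bold>u A) \<Zsemi> \<nabla> A)"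
    using assms by simp
  show "coalg_mor (\<delta> A) (\<delta> A) (\<^bold>1 (\<^bold>!\<^sub>o A))"
    using assms by (simp add: coalg_mor_ident)
  have "((\<^bold>1 (\<^bold>!\<^sub>o A) \<otimes> \<^bold>u A) \<Zsemi> \<nabla> A) \<Zsemi> \<epsilon> A = \<epsilon> A"
    using assms by (simp add: seq_assoc' mult_counit seq_add seq_tensor unit_counit unit_disc)
  then show "((\<^bold>1 (\<^bold>!\<^sub>o A) \<otimes> \<^bold>u A) \<Zsemi> \<nabla> A) \<Zsemi> \<epsilon> A = \<^bold>1 (\<^bold>!\<^sub>o A) \<Zsemi> \<epsilon> A"
    using assms by simp
qed

lemma mult_natural:
  assumes f: "arr f" "tgt f = B"
  shows "(\<^bold>! f \<otimes> \<^bold>! f) \<Zsemi> \<nabla> B = \<nabla> (src f) \<Zsemi> \<^bold>! f"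
proof (rule coalg_mor_unique)
  show B: "B \<in> Obj X"
    using f by auto
  let ?A = "src f"
  show "coalg_mor (tens (\<delta> ?A) (\<delta> ?A)) (\<delta> B) ((\<^bold>! f \<otimes> \<^bold>! f) \<Zsemi> \<nabla> B)"
    using f B by (intro coalg_mor_seq[OF _ coalg_mor_mult] coalg_mor_tensor coalg_mor_bang) auto
  show "coalg_mor (tens (\<delta> ?A) (\<delta> ?A)) (\<delta> B) (\<nabla> ?A \<Zsemi> \<^bold>! f)"
    using f B by (intro coalg_mor_seq[OF coalg_mor_mult] coalg_mor_bang) auto
  have "((\<^bold>! f \<otimes> \<^bold>! f) \<Zsemi> \<nabla> B) \<Zsemi> \<epsilon> B = (\<^bold>! f \<otimes> \<^bold>! f) \<Zsemi> sum_counit B"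
    using f B by (simp add: seq_assoc' mult_counit)
  also have "\<dots> = (\<epsilon> ?A \<Zsemi> f) \<otimes> \<^bold>e ?A \<oplus> \<^bold>e ?A \<otimes> (\<epsilon> ?A \<Zsemi> f)"
    using f B by (simp add: seq_add seq_tensor bang_counit bang_disc)
  also have "\<dots> = (\<epsilon> ?A \<otimes> \<^bold>e ?A) \<Zsemi> (f \<otimes> \<^bold>1 \<^bold>K) \<oplus> (\<^bold>e ?A \<otimes> \<epsilon> ?A) \<Zsemi> (\<^bold>1 \<^bold>K \<otimes> f)"
    using f B by (simp add: seq_tensor del: tensor_unit' unit_tensor')
  also have "\<dots> = sum_counit ?A \<Zsemi> f"
    using f B by (simp add: add_seq)
  also have "\<dots> = \<nabla> ?A \<Zsemi> (\<^bold>! f \<Zsemi> \<epsilon> B)"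
    using f B by (simp add: seq_assoc'[symmetric] mult_counit bang_counit)
  finally show "((\<^bold>! f \<otimes> \<^bold>! f) \<Zsemi> \<nabla> B) \<Zsemi> \<epsilon> B = (\<nabla> ?A \<Zsemi> \<^bold>! f) \<Zsemi> \<epsilon> B"
    using f B by (simp add: seq_assoc')
qed

text \<open>The zero map from \<open>!A\<close> to \<open>B\<close> factors both through \<epsilon>
  and through \<open>e\<close>. Its transpose along \<delta> is computed from each factorization:
  the first gives \<open>!\<close> of zero, the second \<open>e\<close> followed by
  \<open>u\<close>.\<close>

lemma bang_zero:
  assumes "A \<in> Obj X" "B \<in> Obj X"
  shows "\<^bold>! (\<^bold>0 A B) = \<^bold>e A \<Zsemi> \<^bold>u B"
proof -
  have "\<^bold>e A \<Zsemi> \<^bold>u B = (\<^bold>e A \<Zsemi> \<^bold>m\<^sub>K) \<Zsemi> \<^bold>! (\<^bold>0 \<^bold>K B)"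
    using assms by (simp add: unit_promote seq_assoc')
  also have "\<dots> = \<delta> A \<Zsemi> (\<^bold>! (\<^bold>e A) \<Zsemi> \<^bold>! (\<^bold>0 \<^bold>K B))"
    using assms by (simp add: comult_bang_disc[symmetric] seq_assoc')
  also have "\<dots> = \<delta> A \<Zsemi> \<^bold>! (\<^bold>e A \<Zsemi> \<^bold>0 \<^bold>K B)"
    using assms by (simp only: bang_seq arr_modality arr_zero unit_Obj)
  also have "\<dots> = \<delta> A \<Zsemi> \<^bold>! (\<epsilon> A \<Zsemi> \<^bold>0 A B)"
    using assms by simp
  also have "\<dots> = (\<delta> A \<Zsemi> \<^bold>! (\<epsilon> A)) \<Zsemi> \<^bold>! (\<^bold>0 A B)"
    using assms by (simp only: bang_seq seq_assoc' arr_modality arr_zero arr_bang)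
  finally show ?thesis
    using assms by (simp add: comult_bang_counit)
qed

text \<open>The counit half of \<delta> being a comonoid map, derived from naturality of
  \<open>e\<close> at \<epsilon>; only the \<Delta> half is an axiom.\<close>

lemma comult_disc:
  assumes "A \<in> Obj X"
  shows "\<delta> A \<Zsemi> \<^bold>e (\<^bold>!\<^sub>o A) = \<^bold>e A"
proof -
  have "\<delta> A \<Zsemi> \<^bold>e (\<^bold>!\<^sub>o A) = (\<delta> A \<Zsemi> \<^bold>! (\<epsilon> A)) \<Zsemi> \<^bold>e A"
    using assms by (simp add: seq_assoc' bang_disc)
  then show ?thesis
    using assms by (simp add: comult_bang_counit)
qed

text \<open>The target \<open>!A \<otimes> !A\<close> need not be cofree, so uniqueness of coalgebra
  maps cannot be invoked. Instead \<Delta> is moved to the front: by naturality past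
  \<open>sum_counit\<close>, by \<open>m_dupl\<close> past \<open>m\<close>, and by
  \<open>comult_dupl\<close> past \<delta>.\<close>

lemma mult_dupl:
  assumes A: "A \<in> Obj X"
  shows "\<nabla> A \<Zsemi> \<Delta> A = (\<Delta> A \<otimes> \<Delta> A) \<Zsemi> middle (\<^bold>!\<^sub>o A) (\<^bold>!\<^sub>o A) (\<^bold>!\<^sub>o A) (\<^bold>!\<^sub>o A) \<Zsemi> (\<nabla> A \<otimes> \<nabla> A)"
proof -
  let ?B = "\<^bold>!\<^sub>o A" and ?d = "\<delta> A" and ?a = "\<^bold>! (sum_counit A)"
  let ?C = "\<^bold>!\<^sub>o ?B"
  have "\<nabla> A \<Zsemi> \<Delta> A = (?d \<otimes> ?d) \<Zsemi> (\<^bold>m ?B ?B \<Zsemi> \<Delta> (?B \<otimes>\<^sub>o ?B)) \<Zsemi> (?a \<otimes> ?a)"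
    using A by (simp add: ind_mult_def seq_assoc' bang_dupl)
  also have "\<dots> = ((?d \<otimes> ?d) \<Zsemi> (\<Delta> ?B \<otimes> \<Delta> ?B)) \<Zsemi> middle ?C ?C ?C ?C \<Zsemi> (\<^bold>m ?B ?B \<otimes> \<^bold>m ?B ?B) \<Zsemi> (?a \<otimes> ?a)"
    using A by (simp add: m_dupl seq_assoc' flip: middle_def)
  also have "(?d \<otimes> ?d) \<Zsemi> (\<Delta> ?B \<otimes> \<Delta> ?B) = (\<Delta> A \<otimes> \<Delta> A) \<Zsemi> ((?d \<otimes> ?d) \<otimes> (?d \<otimes> ?d))"
    using A by (simp add: seq_tensor comult_dupl del: tensor_assoc')
  also have "\<dots> \<Zsemi> middle ?C ?C ?C ?C = (\<Delta> A \<otimes> \<Delta> A) \<Zsemi> (middle ?B ?B ?B ?B \<Zsemi> (?d \<otimes> ?d \<otimes> ?d \<otimes> ?d))"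
    using A middle_natural[of ?d ?d ?d ?d] by (simp add: seq_assoc')
  also have "\<dots> \<Zsemi> (\<^bold>m ?B ?B \<otimes> \<^bold>m ?B ?B) \<Zsemi> (?a \<otimes> ?a)
      = (\<Delta> A \<otimes> \<Delta> A) \<Zsemi> middle ?B ?B ?B ?B \<Zsemi> (((?d \<otimes> ?d) \<otimes> (?d \<otimes> ?d)) \<Zsemi> (\<^bold>m ?B ?B \<otimes> \<^bold>m ?B ?B) \<Zsemi> (?a \<otimes> ?a))"
    using A by (simp add: seq_assoc')
  also have "((?d \<otimes> ?d) \<otimes> (?d \<otimes> ?d)) \<Zsemi> (\<^bold>m ?B ?B \<otimes> \<^bold>m ?B ?B) \<Zsemi> (?a \<otimes> ?a) = \<nabla> A \<otimes> \<nabla> A"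
    using A by (simp add: ind_mult_def seq_tensor del: tensor_assoc')
  finally show ?thesis .
qed

text \<open>Here the target is cofree, so it suffices to compare after \<epsilon>. On the right each
  summand of \<open>sum_counit\<close> discards one of the two copies made by \<Delta>, and the
  comonoid counit laws absorb the discarded copy.\<close>

lemma m_mult:
  assumes A: "A \<in> Obj X" and B: "B \<in> Obj X"
  shows "(\<^bold>1 (\<^bold>!\<^sub>o A) \<otimes> \<nabla> B) \<Zsemi> \<^bold>m A B
    = (\<Delta> A \<otimes> \<^bold>1 (\<^bold>!\<^sub>o B \<otimes>\<^sub>o \<^bold>!\<^sub>o B)) \<Zsemi> middle (\<^bold>!\<^sub>o A) (\<^bold>!\<^sub>o A) (\<^bold>!\<^sub>o B) (\<^bold>!\<^sub>o B)
        \<Zsemi> (\<^bold>m A B \<otimes> \<^bold>m A B) \<Zsemi> \<nabla> (A \<otimes>\<^sub>o B)" (is "?l = ?r")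
proof (rule coalg_mor_unique)
  let ?a = "\<delta> A" and ?b = "\<delta> B" and ?M = "middle (\<^bold>!\<^sub>o A) (\<^bold>!\<^sub>o A) (\<^bold>!\<^sub>o B) (\<^bold>!\<^sub>o B)"
  show AB: "A \<otimes>\<^sub>o B \<in> Obj X"
    using A B by simp
  show "coalg_mor (tens ?a (tens ?b ?b)) (\<delta> (A \<otimes>\<^sub>o B)) ?l"
    using A B by (intro coalg_mor_seq[OF _ coalg_mor_m] coalg_mor_tensor coalg_mor_ident coalg_mor_mult) auto
  have "coalg_mor (tens ?a (tens ?b ?b)) (tens (tens ?a ?a) (tens ?b ?b))
      (\<Delta> A \<otimes> \<^bold>1 (\<^bold>!\<^sub>o B \<otimes>\<^sub>o \<^bold>!\<^sub>o B))"
    using A B by (intro coalg_mor_tensor coalg_mor_ident coalg_mor_dupl) auto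
  moreover have "coalg_mor (tens (tens ?a ?a) (tens ?b ?b)) (tens (tens ?a ?b) (tens ?a ?b)) ?M"
    using A B coalg_mor_middle[of ?a ?a ?b ?b] by simp
  moreover have "coalg_mor (tens (tens ?a ?b) (tens ?a ?b)) (\<delta> (A \<otimes>\<^sub>o B)) ((\<^bold>m A B \<otimes> \<^bold>m A B) \<Zsemi> \<nabla> (A \<otimes>\<^sub>o B))"
    using A B AB by (intro coalg_mor_seq[OF _ coalg_mor_mult] coalg_mor_tensor coalg_mor_m)
  ultimately have "coalg_mor (tens ?a (tens ?b ?b)) (\<delta> (A \<otimes>\<^sub>o B))
      ((\<Delta> A \<otimes> \<^bold>1 (\<^bold>!\<^sub>o B \<otimes>\<^sub>o \<^bold>!\<^sub>o B)) \<Zsemi> ?M \<Zsemi> ((\<^bold>m A B \<otimes> \<^bold>m A B) \<Zsemi> \<nabla> (A \<otimes>\<^sub>o B)))"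
    by (blast intro: coalg_mor_seq)
  then show "coalg_mor (tens ?a (tens ?b ?b)) (\<delta> (A \<otimes>\<^sub>o B)) ?r"
    using A B by (simp add: seq_assoc')
  have "?l \<Zsemi> \<epsilon> (A \<otimes>\<^sub>o B) = \<epsilon> A \<otimes> \<epsilon> B \<otimes> \<^bold>e B \<oplus> \<epsilon> A \<otimes> \<^bold>e B \<otimes> \<epsilon> B"
    using A B by (simp add: seq_assoc' m_counit seq_tensor mult_counit tensor_add)
  moreover have "?r \<Zsemi> \<epsilon> (A \<otimes>\<^sub>o B) = \<epsilon> A \<otimes> \<epsilon> B \<otimes> \<^bold>e B \<oplus> \<epsilon> A \<otimes> \<^bold>e B \<otimes> \<epsilon> B"
  proof -
    \<comment> \<open>Naturality carries the exchange to the targets, where one of the exchanged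
      objects is the unit, so it disappears.\<close>
    have m1: "?M \<Zsemi> (\<epsilon> A \<otimes> \<epsilon> B \<otimes> \<^bold>e A \<otimes> \<^bold>e B) = \<epsilon> A \<otimes> \<^bold>e A \<otimes> \<epsilon> B \<otimes> \<^bold>e B"
      using A B middle_natural[of "\<epsilon> A" "\<^bold>e A" "\<epsilon> B" "\<^bold>e B"] by (simp add: middle_def)
    have m2: "?M \<Zsemi> (\<^bold>e A \<otimes> \<^bold>e B \<otimes> \<epsilon> A \<otimes> \<epsilon> B) = \<^bold>e A \<otimes> \<epsilon> A \<otimes> \<^bold>e B \<otimes> \<epsilon> B"
      using A B middle_natural[of "\<^bold>e A" "\<epsilon> A" "\<^bold>e B" "\<epsilon> B"] by (simp add: middle_def)
    have "(\<^bold>m A B \<otimes> \<^bold>m A B) \<Zsemi> sum_counit (A \<otimes>\<^sub>o B) = \<epsilon> A \<otimes> \<epsilon> B \<otimes> \<^bold>e A \<otimes> \<^bold>e B \<oplus> \<^bold>e A \<otimes> \<^bold>e B \<otimes> \<epsilon> A \<otimes> \<epsilon> B"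
      using A B by (simp add: seq_add seq_tensor m_counit m_disc)
    then have "?M \<Zsemi> ((\<^bold>m A B \<otimes> \<^bold>m A B) \<Zsemi> sum_counit (A \<otimes>\<^sub>o B))
        = \<epsilon> A \<otimes> \<^bold>e A \<otimes> \<epsilon> B \<otimes> \<^bold>e B \<oplus> \<^bold>e A \<otimes> \<epsilon> A \<otimes> \<^bold>e B \<otimes> \<epsilon> B"
      using A B by (simp add: seq_add m1 m2)
    moreover have "?r \<Zsemi> \<epsilon> (A \<otimes>\<^sub>o B) = (\<Delta> A \<otimes> \<^bold>1 (\<^bold>!\<^sub>o B \<otimes>\<^sub>o \<^bold>!\<^sub>o B)) \<Zsemi> (?M \<Zsemi> ((\<^bold>m A B \<otimes> \<^bold>m A B) \<Zsemi> sum_counit (A \<otimes>\<^sub>o B)))"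
      using A B by (simp add: seq_assoc' mult_counit)
    moreover have "(\<Delta> A \<otimes> \<^bold>1 (\<^bold>!\<^sub>o B \<otimes>\<^sub>o \<^bold>!\<^sub>o B)) \<Zsemi> ((\<epsilon> A \<otimes> \<^bold>e A) \<otimes> (\<epsilon> B \<otimes> \<^bold>e B)) = \<epsilon> A \<otimes> \<epsilon> B \<otimes> \<^bold>e B"
    proof -
      have "\<Delta> A \<Zsemi> (\<epsilon> A \<otimes> \<^bold>e A) = (\<Delta> A \<Zsemi> (\<^bold>1 (\<^bold>!\<^sub>o A) \<otimes> \<^bold>e A)) \<Zsemi> (\<epsilon> A \<otimes> \<^bold>1 \<^bold>K)"
        using A by (simp add: seq_assoc' seq_tensor del: tensor_unit')
      then show ?thesis
        using A B by (simp add: seq_tensor dupl_disc_right del: tensor_assoc')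
    qed
    moreover have "(\<Delta> A \<otimes> \<^bold>1 (\<^bold>!\<^sub>o B \<otimes>\<^sub>o \<^bold>!\<^sub>o B)) \<Zsemi> ((\<^bold>e A \<otimes> \<epsilon> A) \<otimes> (\<^bold>e B \<otimes> \<epsilon> B)) = \<epsilon> A \<otimes> \<^bold>e B \<otimes> \<epsilon> B"
    proof -
      have "\<Delta> A \<Zsemi> (\<^bold>e A \<otimes> \<epsilon> A) = (\<Delta> A \<Zsemi> (\<^bold>e A \<otimes> \<^bold>1 (\<^bold>!\<^sub>o A))) \<Zsemi> (\<^bold>1 \<^bold>K \<otimes> \<epsilon> A)"
        using A by (simp add: seq_assoc' seq_tensor del: unit_tensor')
      then show ?thesis
        using A B by (simp add: seq_tensor dupl_disc_left del: tensor_assoc')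
    qed
    ultimately show ?thesis
      using A B by (simp add: seq_add)
  qed
  ultimately show "?l \<Zsemi> \<epsilon> (A \<otimes>\<^sub>o B) = ?r \<Zsemi> \<epsilon> (A \<otimes>\<^sub>o B)"
    by simp
qed

lemma unit_mult':
  assumes "arr f" "tgt f = \<^bold>!\<^sub>o A" "A \<in> Obj X"
  shows "(\<^bold>u A \<otimes> f) \<Zsemi> \<nabla> A = f"
proof -
  have "(\<^bold>u A \<otimes> f) \<Zsemi> \<nabla> A = (\<^bold>1 \<^bold>K \<otimes> f) \<Zsemi> ((\<^bold>u A \<otimes> \<^bold>1 (\<^bold>!\<^sub>o A)) \<Zsemi> \<nabla> A)"
    using assms by (simp add: seq_assoc'[symmetric] seq_tensor del: unit_tensor')
  then show ?thesis
    using assms by (simp add: unit_mult)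
qed

lemma mult_unit':
  assumes "arr f" "tgt f = \<^bold>!\<^sub>o A" "A \<in> Obj X"
  shows "(f \<otimes> \<^bold>u A) \<Zsemi> \<nabla> A = f"
proof -
  have "(f \<otimes> \<^bold>u A) \<Zsemi> \<nabla> A = (f \<otimes> \<^bold>1 \<^bold>K) \<Zsemi> ((\<^bold>1 (\<^bold>!\<^sub>o A) \<otimes> \<^bold>u A) \<Zsemi> \<nabla> A)"
    using assms by (simp add: seq_assoc'[symmetric] seq_tensor del: tensor_unit')
  then show ?thesis
    using assms by (simp add: mult_unit)
qed

end

subsection \<open>Linear natural transformations\<close>

text \<open>Each of the three conditions of the theorem contains the linear rule, so all
  implications can be proved under it; if it fails, all three conditions fail together.\<close>

locale linear_natural = additive_linear_category X
  for X :: "('o, 'a, 'z) monoidal_coalgebra_modality_scheme" (structure) +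
  fixes \<eta> :: "'o \<Rightarrow> 'a"
  assumes natural: "natural_transformation X (\<lambda>A. A) (\<lambda>f. f) \<^bold>!\<^sub>o \<^bold>! \<eta>"
    and linear: "linear_rule X \<eta>"
begin

lemma arr_eta [simp]:
  assumes "A \<in> Obj X"
  shows "arr (\<eta> A)" and "src (\<eta> A) = A" and "tgt (\<eta> A) = \<^bold>!\<^sub>o A"
  using natural assms by (auto simp: natural_transformation_def in_Hom_iff)

lemma eta_bang: "arr f \<Longrightarrow> src f = A \<Longrightarrow> \<eta> A \<Zsemi> \<^bold>! f = f \<Zsemi> \<eta> (tgt f)"
  using natural by (auto simp: natural_transformation_def in_Hom_iff)

lemma eta_counit: "A \<in> Obj X \<Longrightarrow> \<eta> A \<Zsemi> \<epsilon> A = \<^bold>1 A"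
  using linear by (simp add: linear_rule_def)

section \<open>The constant and product rules\<close>

lemma eta_disc:
  assumes "A \<in> Obj X"
  shows "\<eta> A \<Zsemi> \<^bold>e A = \<^bold>0 A \<^bold>K"
proof -
  have "\<eta> A \<Zsemi> \<^bold>e A = (\<eta> A \<Zsemi> \<^bold>! (\<^bold>0 A A)) \<Zsemi> \<^bold>e A"
    using assms by (simp add: seq_assoc' bang_disc)
  then show ?thesis
    using assms by (simp add: eta_bang)
qed

text \<open>The left side is additive in \<open>f\<close>, although \<open>!\<close> is not; the
  right side depends on \<open>f\<close> only through its composites with \<open>p\<close> and
  \<open>q\<close>. Reading the equation in both directions splits a sum and then evaluates its
  summands.\<close>

lemma eta_dupl_split:
  assumes f: "arr f" "src f = A" "tgt f = B" and p: "arr p" "src p = B" and q: "arr q" "src q = B"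
  shows "f \<Zsemi> (\<eta> B \<Zsemi> (\<Delta> B \<Zsemi> (\<^bold>! p \<otimes> \<^bold>! q))) = \<eta> A \<Zsemi> (\<Delta> A \<Zsemi> (\<^bold>! (f \<Zsemi> p) \<otimes> \<^bold>! (f \<Zsemi> q)))"
proof -
  have AB: "A \<in> Obj X" "B \<in> Obj X"
    using f by auto
  have "f \<Zsemi> (\<eta> B \<Zsemi> (\<Delta> B \<Zsemi> (\<^bold>! p \<otimes> \<^bold>! q))) = (f \<Zsemi> \<eta> B) \<Zsemi> (\<Delta> B \<Zsemi> (\<^bold>! p \<otimes> \<^bold>! q))"
    using f p q AB by (simp add: seq_assoc')
  also have "f \<Zsemi> \<eta> B = \<eta> A \<Zsemi> \<^bold>! f"
    using f by (simp add: eta_bang)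
  also have "\<dots> \<Zsemi> (\<Delta> B \<Zsemi> (\<^bold>! p \<otimes> \<^bold>! q)) = \<eta> A \<Zsemi> ((\<^bold>! f \<Zsemi> \<Delta> B) \<Zsemi> (\<^bold>! p \<otimes> \<^bold>! q))"
    using f p q AB by (simp add: seq_assoc')
  also have "\<^bold>! f \<Zsemi> \<Delta> B = \<Delta> A \<Zsemi> (\<^bold>! f \<otimes> \<^bold>! f)"
    using f by (simp add: bang_dupl)
  finally show ?thesis
    using f p q AB by (simp add: seq_assoc' seq_tensor bang_seq)
qed

text \<open>The object \<open>!A \<otimes> !A\<close> has injections \<open>\<eta> \<otimes> u\<close>, \<open>u \<otimes> \<eta>\<close> and projections \<open>\<epsilon> \<otimes> e\<close>, \<open>e \<otimes> \<epsilon>\<close>.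
  By naturality of \<open>\<eta>\<close> at the sum of the injections, \<open>\<eta> \<Delta>\<close> splits into two summands.\<close>

lemma eta_dupl:
  assumes A: "A \<in> Obj X"
  shows "\<eta> A \<Zsemi> \<Delta> A = \<eta> A \<otimes> \<^bold>u A \<oplus> \<^bold>u A \<otimes> \<eta> A"
proof -
  let ?B = "\<^bold>!\<^sub>o A \<otimes>\<^sub>o \<^bold>!\<^sub>o A"
  let ?f = "\<eta> A \<otimes> \<^bold>u A" and ?g = "\<^bold>u A \<otimes> \<eta> A" and ?p = "\<epsilon> A \<otimes> \<^bold>e A" and ?q = "\<^bold>e A \<otimes> \<epsilon> A"
  have fp: "?f \<Zsemi> ?p = \<^bold>1 A" and fq: "?f \<Zsemi> ?q = \<^bold>0 A A"
    and gp: "?g \<Zsemi> ?p = \<^bold>0 A A" and gq: "?g \<Zsemi> ?q = \<^bold>1 A"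
    using A by (simp_all add: seq_tensor eta_counit eta_disc unit_counit unit_disc)
  \<comment> \<open>The sum of the injections behaves like a diagonal: both projections return the
    identity.\<close>
  have "(?f \<oplus> ?g) \<Zsemi> ?p = \<^bold>1 A" and "(?f \<oplus> ?g) \<Zsemi> ?q = \<^bold>1 A"
    using A by (simp_all add: add_seq fp fq gp gq)
  then have "\<eta> A \<Zsemi> \<Delta> A = (?f \<oplus> ?g) \<Zsemi> (\<eta> ?B \<Zsemi> (\<Delta> ?B \<Zsemi> (\<^bold>! ?p \<otimes> \<^bold>! ?q)))"
    using A eta_dupl_split[of "?f \<oplus> ?g" A ?B ?p ?q] by simp
  also have "\<dots> = ?f \<Zsemi> (\<eta> ?B \<Zsemi> (\<Delta> ?B \<Zsemi> (\<^bold>! ?p \<otimes> \<^bold>! ?q)))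
      \<oplus> ?g \<Zsemi> (\<eta> ?B \<Zsemi> (\<Delta> ?B \<Zsemi> (\<^bold>! ?p \<otimes> \<^bold>! ?q)))"
    using A by (simp add: add_seq)
  also have "?f \<Zsemi> (\<eta> ?B \<Zsemi> (\<Delta> ?B \<Zsemi> (\<^bold>! ?p \<otimes> \<^bold>! ?q))) = ?f"
  proof -
    \<comment> \<open>The second component is \<open>!\<close> of zero, hence \<open>e\<close>
      followed by \<open>u\<close>; the counit law of \<Delta> then removes the duplication.\<close>
    have "?f \<Zsemi> (\<eta> ?B \<Zsemi> (\<Delta> ?B \<Zsemi> (\<^bold>! ?p \<otimes> \<^bold>! ?q))) = \<eta> A \<Zsemi> (\<Delta> A \<Zsemi> (\<^bold>1 (\<^bold>!\<^sub>o A) \<otimes> (\<^bold>e A \<Zsemi> \<^bold>u A)))"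
      using A eta_dupl_split[of ?f A ?B ?p ?q] by (simp add: fp fq bang_zero)
    also have "\<dots> = \<eta> A \<Zsemi> ((\<Delta> A \<Zsemi> (\<^bold>1 (\<^bold>!\<^sub>o A) \<otimes> \<^bold>e A)) \<Zsemi> (\<^bold>1 (\<^bold>!\<^sub>o A) \<otimes> \<^bold>u A))"
      using A by (simp add: seq_assoc' seq_tensor)
    also have "\<dots> = (\<eta> A \<otimes> \<^bold>1 \<^bold>K) \<Zsemi> (\<^bold>1 (\<^bold>!\<^sub>o A) \<otimes> \<^bold>u A)"
      using A by (simp add: dupl_disc_right)
    also have "\<dots> = ?f"
      using A by (simp add: seq_tensor del: tensor_unit')
    finally show ?thesis .
  qed
  also have "?g \<Zsemi> (\<eta> ?B \<Zsemi> (\<Delta> ?B \<Zsemi> (\<^bold>! ?p \<otimes> \<^bold>! ?q))) = ?g"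
  proof -
    have "?g \<Zsemi> (\<eta> ?B \<Zsemi> (\<Delta> ?B \<Zsemi> (\<^bold>! ?p \<otimes> \<^bold>! ?q))) = \<eta> A \<Zsemi> (\<Delta> A \<Zsemi> ((\<^bold>e A \<Zsemi> \<^bold>u A) \<otimes> \<^bold>1 (\<^bold>!\<^sub>o A)))"
      using A eta_dupl_split[of ?g A ?B ?p ?q] by (simp add: gp gq bang_zero)
    also have "\<dots> = \<eta> A \<Zsemi> ((\<Delta> A \<Zsemi> (\<^bold>e A \<otimes> \<^bold>1 (\<^bold>!\<^sub>o A))) \<Zsemi> (\<^bold>u A \<otimes> \<^bold>1 (\<^bold>!\<^sub>o A)))"
      using A by (simp add: seq_assoc' seq_tensor)
    also have "\<dots> = (\<^bold>1 \<^bold>K \<otimes> \<eta> A) \<Zsemi> (\<^bold>u A \<otimes> \<^bold>1 (\<^bold>!\<^sub>o A))"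
      using A by (simp add: dupl_disc_left)
    also have "\<dots> = ?g"
      using A by (simp add: seq_tensor del: unit_tensor')
    finally show ?thesis .
  qed
  finally show ?thesis .
qed

lemma codereliction_iff: "codereliction X \<nabla> \<^bold>u \<eta> \<longleftrightarrow> chain_rule X \<nabla> \<eta>"
  by (simp add: codereliction_def constant_rule_def product_rule_def natural linear eta_disc eta_dupl)

text \<open>Precompose the chain rule with \<open>u\<close>. On the left \<open>u\<close> is a unit
  for \<nabla>; on the right \<Delta> duplicates it, and \<nabla> absorbs one of the two
  copies.\<close>

lemma chain_imp_alternative_chain:
  assumes chain: "chain_rule X \<nabla> \<eta>"
  shows "alternative_chain_rule X \<nabla> \<^bold>u \<eta>"
  unfolding alternative_chain_rule_def
proof
  fix A
  assume A: "A \<in> Obj X"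
  let ?B = "\<^bold>!\<^sub>o A"
  have "\<eta> A \<Zsemi> \<delta> A = ((\<^bold>u A \<otimes> \<eta> A) \<Zsemi> \<nabla> A) \<Zsemi> \<delta> A"
    using A by (simp add: unit_mult')
  also have "\<dots> = (\<^bold>u A \<otimes> \<^bold>1 A) \<Zsemi> ((\<^bold>1 ?B \<otimes> \<eta> A) \<Zsemi> \<nabla> A \<Zsemi> \<delta> A)"
    using A by (simp add: seq_assoc'[symmetric] seq_tensor)
  also have "(\<^bold>1 ?B \<otimes> \<eta> A) \<Zsemi> \<nabla> A \<Zsemi> \<delta> A
      = (\<Delta> A \<otimes> \<eta> A) \<Zsemi> (\<^bold>1 ?B \<otimes> \<nabla> A) \<Zsemi> (\<delta> A \<otimes> \<eta> ?B) \<Zsemi> \<nabla> ?B"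
    using A chain by (simp add: chain_rule_def)
  also have "(\<^bold>u A \<otimes> \<^bold>1 A) \<Zsemi> \<dots>
      = ((\<^bold>u A \<otimes> \<^bold>1 A) \<Zsemi> (\<Delta> A \<otimes> \<eta> A)) \<Zsemi> (\<^bold>1 ?B \<otimes> \<nabla> A) \<Zsemi> (\<delta> A \<otimes> \<eta> ?B) \<Zsemi> \<nabla> ?B"
    using A by (simp add: seq_assoc')
  also have "(\<^bold>u A \<otimes> \<^bold>1 A) \<Zsemi> (\<Delta> A \<otimes> \<eta> A) = \<^bold>u A \<otimes> (\<^bold>u A \<otimes> \<eta> A)"
    using A by (simp add: seq_tensor unit_dupl)
  also have "\<dots> \<Zsemi> (\<^bold>1 ?B \<otimes> \<nabla> A) = \<^bold>u A \<otimes> \<eta> A"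
    using A by (simp add: seq_tensor unit_mult')
  finally show "\<eta> A \<Zsemi> \<delta> A = (\<^bold>u A \<otimes> \<eta> A) \<Zsemi> (\<delta> A \<otimes> \<eta> ?B) \<Zsemi> \<nabla> ?B" .
qed

text \<open>Through \<open>S = !A \<otimes> !B\<close> the map \<open>m\<close> is expressed by \<open>\<nabla>\<close>, \<open>\<delta>\<close> and \<open>\<Delta>\<close> (\<open>m_eq\<close> below), so that
  the chain rule applies to \<open>(1 \<otimes> \<eta>) m\<close>.\<close>

lemma chain_imp_monoidal:
  assumes chain: "chain_rule X \<nabla> \<eta>"
  shows "monoidal_rule X \<eta>"
  unfolding monoidal_rule_def
proof (intro ballI)
  fix A B
  assume AB [simp]: "A \<in> Obj X" "B \<in> Obj X"
  define S where "S = \<^bold>!\<^sub>o A \<otimes>\<^sub>o \<^bold>!\<^sub>o B"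
  define f where "f = \<eta> A \<otimes> \<^bold>u B"
  define g where "g = \<^bold>u A \<otimes> \<eta> B"
  define p where "p = \<epsilon> A \<otimes> \<^bold>e B"
  define q where "q = \<^bold>e A \<otimes> \<epsilon> B"
  \<comment> \<open>This \<open>h\<close> is the retraction of \<open>!S\<close> onto
    \<open>S\<close> followed by \<open>\<epsilon> \<otimes> \<epsilon>\<close>, the map whose
    transpose is \<open>m\<close>.\<close>
  define h where "h = \<Delta> S \<Zsemi> (\<^bold>! p \<otimes> \<^bold>! q) \<Zsemi> (\<epsilon> A \<otimes> \<epsilon> B)"
  have [simp]: "S \<in> Obj X" "arr f" "src f = A" "tgt f = S" "arr g" "src g = B" "tgt g = S"
    "arr p" "src p = S" "tgt p = A" "arr q" "src q = S" "tgt q = B"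
    by (auto simp: S_def f_def g_def p_def q_def)
  then have [simp]: "arr h" "src h = \<^bold>!\<^sub>o S" "tgt h = A \<otimes>\<^sub>o B"
    by (auto simp: h_def)
  have fp: "f \<Zsemi> p = \<^bold>1 A" and fq: "f \<Zsemi> q = \<^bold>0 A B"
    and gp: "g \<Zsemi> p = \<^bold>0 B A" and gq: "g \<Zsemi> q = \<^bold>1 B"
    by (simp_all add: f_def g_def p_def q_def seq_tensor eta_counit eta_disc unit_counit unit_disc)

  \<comment> \<open>Naturality of \<nabla> brings \<open>p\<close> to each factor; on the second it
    gives \<open>!\<close> of zero, which contributes only a unit for \<nabla>.\<close>
  have fgp: "(\<^bold>! f \<otimes> \<^bold>! g) \<Zsemi> \<nabla> S \<Zsemi> \<^bold>! p = \<^bold>1 (\<^bold>!\<^sub>o A) \<otimes> \<^bold>e B"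
  proof -
    have "(\<^bold>! f \<otimes> \<^bold>! g) \<Zsemi> \<nabla> S \<Zsemi> \<^bold>! p = (\<^bold>! f \<otimes> \<^bold>! g) \<Zsemi> ((\<^bold>! p \<otimes> \<^bold>! p) \<Zsemi> \<nabla> A)"
      by (simp add: seq_assoc' mult_natural)
    also have "\<dots> = (\<^bold>! (f \<Zsemi> p) \<otimes> \<^bold>! (g \<Zsemi> p)) \<Zsemi> \<nabla> A"
      by (simp add: seq_assoc'[symmetric] seq_tensor bang_seq)
    also have "\<dots> = (\<^bold>1 (\<^bold>!\<^sub>o A) \<otimes> \<^bold>e B) \<Zsemi> ((\<^bold>1 (\<^bold>!\<^sub>o A) \<otimes> \<^bold>u A) \<Zsemi> \<nabla> A)"
      by (simp add: fp gp bang_zero seq_assoc'[symmetric] seq_tensor)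
    finally show ?thesis
      by (simp add: mult_unit)
  qed
  have fgq: "(\<^bold>! f \<otimes> \<^bold>! g) \<Zsemi> \<nabla> S \<Zsemi> \<^bold>! q = \<^bold>e A \<otimes> \<^bold>1 (\<^bold>!\<^sub>o B)"
  proof -
    have "(\<^bold>! f \<otimes> \<^bold>! g) \<Zsemi> \<nabla> S \<Zsemi> \<^bold>! q = (\<^bold>! f \<otimes> \<^bold>! g) \<Zsemi> ((\<^bold>! q \<otimes> \<^bold>! q) \<Zsemi> \<nabla> B)"
      by (simp add: seq_assoc' mult_natural)
    also have "\<dots> = (\<^bold>! (f \<Zsemi> q) \<otimes> \<^bold>! (g \<Zsemi> q)) \<Zsemi> \<nabla> B"
      by (simp add: seq_assoc'[symmetric] seq_tensor bang_seq)
    also have "\<dots> = (\<^bold>e A \<otimes> \<^bold>1 (\<^bold>!\<^sub>o B)) \<Zsemi> ((\<^bold>u B \<otimes> \<^bold>1 (\<^bold>!\<^sub>o B)) \<Zsemi> \<nabla> B)"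
      by (simp add: fq gq bang_zero seq_assoc'[symmetric] seq_tensor)
    finally show ?thesis
      by (simp add: unit_mult)
  qed
  \<comment> \<open>The retraction of \<open>!S\<close> onto \<open>S\<close>: the bialgebra law
    reduces it to \<open>fgp\<close> and \<open>fgq\<close>, and the counit laws finish.\<close>
  have fg_split: "(\<^bold>! f \<otimes> \<^bold>! g) \<Zsemi> \<nabla> S \<Zsemi> (\<Delta> S \<Zsemi> (\<^bold>! p \<otimes> \<^bold>! q)) = \<^bold>1 S"
  proof -
    let ?M = "middle (\<^bold>!\<^sub>o A) (\<^bold>!\<^sub>o A) (\<^bold>!\<^sub>o B) (\<^bold>!\<^sub>o B)"
    let ?N = "middle (\<^bold>!\<^sub>o S) (\<^bold>!\<^sub>o S) (\<^bold>!\<^sub>o S) (\<^bold>!\<^sub>o S)"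
    have "(\<^bold>! f \<otimes> \<^bold>! g) \<Zsemi> \<nabla> S \<Zsemi> (\<Delta> S \<Zsemi> (\<^bold>! p \<otimes> \<^bold>! q))
        = (\<^bold>! f \<otimes> \<^bold>! g) \<Zsemi> ((\<nabla> S \<Zsemi> \<Delta> S) \<Zsemi> (\<^bold>! p \<otimes> \<^bold>! q))"
      by (simp add: seq_assoc')
    also have "\<dots> = ((\<^bold>! f \<otimes> \<^bold>! g) \<Zsemi> (\<Delta> S \<otimes> \<Delta> S)) \<Zsemi> ?N \<Zsemi> ((\<nabla> S \<otimes> \<nabla> S) \<Zsemi> (\<^bold>! p \<otimes> \<^bold>! q))"
      by (simp add: mult_dupl seq_assoc')
    also have "(\<^bold>! f \<otimes> \<^bold>! g) \<Zsemi> (\<Delta> S \<otimes> \<Delta> S) = (\<Delta> A \<otimes> \<Delta> B) \<Zsemi> ((\<^bold>! f \<otimes> \<^bold>! f) \<otimes> (\<^bold>! g \<otimes> \<^bold>! g))"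
      by (simp add: seq_tensor bang_dupl del: tensor_assoc')
    also have "\<dots> \<Zsemi> ?N = (\<Delta> A \<otimes> \<Delta> B) \<Zsemi> (?M \<Zsemi> (\<^bold>! f \<otimes> \<^bold>! g \<otimes> \<^bold>! f \<otimes> \<^bold>! g))"
      using middle_natural[of "\<^bold>! f" "\<^bold>! f" "\<^bold>! g" "\<^bold>! g"] by (simp add: seq_assoc')
    also have "\<dots> \<Zsemi> ((\<nabla> S \<otimes> \<nabla> S) \<Zsemi> (\<^bold>! p \<otimes> \<^bold>! q))
        = (\<Delta> A \<otimes> \<Delta> B) \<Zsemi> (?M \<Zsemi> (((\<^bold>! f \<otimes> \<^bold>! g) \<otimes> (\<^bold>! f \<otimes> \<^bold>! g)) \<Zsemi> (\<nabla> S \<otimes> \<nabla> S) \<Zsemi> (\<^bold>! p \<otimes> \<^bold>! q)))"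
      by (simp add: seq_assoc')
    also have "((\<^bold>! f \<otimes> \<^bold>! g) \<otimes> (\<^bold>! f \<otimes> \<^bold>! g)) \<Zsemi> (\<nabla> S \<otimes> \<nabla> S) \<Zsemi> (\<^bold>! p \<otimes> \<^bold>! q)
        = (\<^bold>1 (\<^bold>!\<^sub>o A) \<otimes> \<^bold>e B) \<otimes> (\<^bold>e A \<otimes> \<^bold>1 (\<^bold>!\<^sub>o B))"
      by (simp add: seq_tensor fgp fgq del: tensor_assoc')
    also have "?M \<Zsemi> \<dots> = (\<^bold>1 (\<^bold>!\<^sub>o A) \<otimes> \<^bold>e A) \<otimes> (\<^bold>e B \<otimes> \<^bold>1 (\<^bold>!\<^sub>o B))"
      using middle_natural[of "\<^bold>1 (\<^bold>!\<^sub>o A)" "\<^bold>e A" "\<^bold>e B" "\<^bold>1 (\<^bold>!\<^sub>o B)"] by (simp add: middle_def)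
    also have "(\<Delta> A \<otimes> \<Delta> B) \<Zsemi> \<dots> = \<^bold>1 S"
      by (simp add: seq_tensor dupl_disc_left dupl_disc_right S_def del: tensor_assoc')
    finally show ?thesis .
  qed
  have fgh: "(\<^bold>! f \<otimes> \<^bold>! g) \<Zsemi> \<nabla> S \<Zsemi> h = \<epsilon> A \<otimes> \<epsilon> B"
  proof -
    have "(\<^bold>! f \<otimes> \<^bold>! g) \<Zsemi> \<nabla> S \<Zsemi> h
        = ((\<^bold>! f \<otimes> \<^bold>! g) \<Zsemi> \<nabla> S \<Zsemi> (\<Delta> S \<Zsemi> (\<^bold>! p \<otimes> \<^bold>! q))) \<Zsemi> (\<epsilon> A \<otimes> \<epsilon> B)"
      by (simp add: h_def seq_assoc')
    then show ?thesis
      unfolding fg_split by (simp add: S_def)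
  qed
  \<comment> \<open>The part before \<delta> is a coalgebra map, so the right side is the transpose
    of \<open>\<epsilon> \<otimes> \<epsilon>\<close> by \<open>fgh\<close>; so is \<open>m\<close>,
    by \<open>m_counit\<close>.\<close>
  have m_eq: "\<^bold>m A B = (\<^bold>! f \<otimes> \<^bold>! g) \<Zsemi> (\<nabla> S \<Zsemi> \<delta> S) \<Zsemi> \<^bold>! h"
  proof -
    have "coalg_mor (tens (\<delta> A) (\<delta> B)) (\<delta> S) ((\<^bold>! f \<otimes> \<^bold>! g) \<Zsemi> \<nabla> S)"
      by (intro coalg_mor_seq[OF _ coalg_mor_mult] coalg_mor_tensor coalg_mor_bang) simp_all
    then have "((\<^bold>! f \<otimes> \<^bold>! g) \<Zsemi> \<nabla> S) \<Zsemi> \<delta> S = tens (\<delta> A) (\<delta> B) \<Zsemi> \<^bold>! ((\<^bold>! f \<otimes> \<^bold>! g) \<Zsemi> \<nabla> S)"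
      by (simp add: coalg_mor_def)
    then have "(\<^bold>! f \<otimes> \<^bold>! g) \<Zsemi> (\<nabla> S \<Zsemi> \<delta> S) \<Zsemi> \<^bold>! h
        = (tens (\<delta> A) (\<delta> B) \<Zsemi> \<^bold>! ((\<^bold>! f \<otimes> \<^bold>! g) \<Zsemi> \<nabla> S)) \<Zsemi> \<^bold>! h"
      by (simp add: seq_assoc')
    also have "\<dots> = tens (\<delta> A) (\<delta> B) \<Zsemi> \<^bold>! ((\<^bold>! f \<otimes> \<^bold>! g) \<Zsemi> \<nabla> S \<Zsemi> h)"
      by (simp add: seq_assoc' bang_seq)
    also have "\<dots> = \<^bold>m A B"
      using coalg_mor_eq_promote[OF coalg_mor_m, of A B] by (simp add: fgh m_counit)
    finally show ?thesis
      by simp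
  qed

  \<comment> \<open>On elements coming from \<open>A\<close> alone, the tensor in \<open>h\<close>
    has a zero factor, since \<open>f\<close> followed by \<open>q\<close> is zero.\<close>
  have fh: "\<^bold>! f \<Zsemi> (\<delta> S \<Zsemi> \<^bold>! h) = \<^bold>e A \<Zsemi> \<^bold>u (A \<otimes>\<^sub>o B)"
  proof -
    have "\<^bold>! f \<Zsemi> h = (\<^bold>! f \<Zsemi> \<Delta> S) \<Zsemi> ((\<^bold>! p \<Zsemi> \<epsilon> A) \<otimes> (\<^bold>! q \<Zsemi> \<epsilon> B))"
      by (simp add: h_def seq_assoc' seq_tensor)
    also have "\<dots> = \<Delta> A \<Zsemi> ((\<^bold>! f \<Zsemi> (\<epsilon> S \<Zsemi> p)) \<otimes> (\<^bold>! f \<Zsemi> (\<epsilon> S \<Zsemi> q)))"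
      by (simp add: bang_dupl bang_counit seq_assoc' seq_tensor)
    also have "\<^bold>! f \<Zsemi> (\<epsilon> S \<Zsemi> q) = (\<^bold>! f \<Zsemi> \<epsilon> S) \<Zsemi> q"
      by (simp add: seq_assoc')
    also have "\<dots> = \<epsilon> A \<Zsemi> (f \<Zsemi> q)"
      by (simp add: bang_counit seq_assoc')
    also have "\<dots> = \<^bold>0 (\<^bold>!\<^sub>o A) B"
      by (simp add: fq)
    finally have fh0: "\<^bold>! f \<Zsemi> h = \<^bold>0 (\<^bold>!\<^sub>o A) (A \<otimes>\<^sub>o B)"
      by simp
    have "\<^bold>! f \<Zsemi> (\<delta> S \<Zsemi> \<^bold>! h) = (\<^bold>! f \<Zsemi> \<delta> S) \<Zsemi> \<^bold>! h"
      by (simp add: seq_assoc')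
    also have "\<dots> = \<delta> A \<Zsemi> \<^bold>! (\<^bold>! f \<Zsemi> h)"
      by (simp add: bang_comult seq_assoc' bang_seq)
    also have "\<dots> = (\<delta> A \<Zsemi> \<^bold>e (\<^bold>!\<^sub>o A)) \<Zsemi> \<^bold>u (A \<otimes>\<^sub>o B)"
      by (simp add: fh0 bang_zero seq_assoc')
    finally show ?thesis
      by (simp add: comult_disc)
  qed
  have gh: "(\<^bold>! f \<otimes> (g \<Zsemi> \<eta> S)) \<Zsemi> (\<nabla> S \<Zsemi> h) = \<epsilon> A \<otimes> \<^bold>1 B"
  proof -
    have "\<^bold>! f \<otimes> (g \<Zsemi> \<eta> S) = (\<^bold>1 (\<^bold>!\<^sub>o A) \<otimes> \<eta> B) \<Zsemi> (\<^bold>! f \<otimes> \<^bold>! g)"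
      by (simp add: seq_tensor eta_bang)
    then have "(\<^bold>! f \<otimes> (g \<Zsemi> \<eta> S)) \<Zsemi> (\<nabla> S \<Zsemi> h)
        = (\<^bold>1 (\<^bold>!\<^sub>o A) \<otimes> \<eta> B) \<Zsemi> ((\<^bold>! f \<otimes> \<^bold>! g) \<Zsemi> \<nabla> S \<Zsemi> h)"
      by (simp add: seq_assoc')
    then show ?thesis
      by (simp add: fgh seq_tensor eta_counit)
  qed

  let ?T = "A \<otimes>\<^sub>o B" and ?Q = "\<^bold>!\<^sub>o S"
  have "(\<^bold>1 (\<^bold>!\<^sub>o A) \<otimes> \<eta> B) \<Zsemi> \<^bold>m A B
      = ((\<^bold>1 (\<^bold>!\<^sub>o A) \<otimes> \<eta> B) \<Zsemi> (\<^bold>! f \<otimes> \<^bold>! g)) \<Zsemi> (\<nabla> S \<Zsemi> \<delta> S) \<Zsemi> \<^bold>! h"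
    by (simp add: m_eq seq_assoc')
  also have "(\<^bold>1 (\<^bold>!\<^sub>o A) \<otimes> \<eta> B) \<Zsemi> (\<^bold>! f \<otimes> \<^bold>! g) = (\<^bold>! f \<otimes> g) \<Zsemi> (\<^bold>1 ?Q \<otimes> \<eta> S)"
    by (simp add: seq_tensor eta_bang)
  also have "\<dots> \<Zsemi> (\<nabla> S \<Zsemi> \<delta> S) \<Zsemi> \<^bold>! h = (\<^bold>! f \<otimes> g) \<Zsemi> ((\<^bold>1 ?Q \<otimes> \<eta> S) \<Zsemi> \<nabla> S \<Zsemi> \<delta> S) \<Zsemi> \<^bold>! h"
    by (simp add: seq_assoc')
  \<comment> \<open>The chain rule produces two factors under \<nabla>. By \<open>fh\<close> the
    first becomes \<open>e\<close> followed by \<open>u\<close>, a unit that \<nabla> absorbs; by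
    \<open>gh\<close> the second becomes the right side of the monoidal rule.\<close>
  also have "(\<^bold>1 ?Q \<otimes> \<eta> S) \<Zsemi> \<nabla> S \<Zsemi> \<delta> S
      = (\<Delta> S \<otimes> \<eta> S) \<Zsemi> (\<^bold>1 ?Q \<otimes> \<nabla> S) \<Zsemi> (\<delta> S \<otimes> \<eta> ?Q) \<Zsemi> \<nabla> ?Q"
    using chain by (simp add: chain_rule_def)
  also have "(\<^bold>! f \<otimes> g) \<Zsemi> \<dots> \<Zsemi> \<^bold>! h
      = ((\<^bold>! f \<otimes> g) \<Zsemi> (\<Delta> S \<otimes> \<eta> S)) \<Zsemi> ((\<^bold>1 ?Q \<otimes> \<nabla> S) \<Zsemi> (\<delta> S \<otimes> \<eta> ?Q) \<Zsemi> (\<nabla> ?Q \<Zsemi> \<^bold>! h))"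
    by (simp add: seq_assoc')
  also have "\<nabla> ?Q \<Zsemi> \<^bold>! h = (\<^bold>! h \<otimes> \<^bold>! h) \<Zsemi> \<nabla> ?T"
    by (simp add: mult_natural)
  also have "(\<^bold>1 ?Q \<otimes> \<nabla> S) \<Zsemi> (\<delta> S \<otimes> \<eta> ?Q) \<Zsemi> \<dots>
      = ((\<^bold>1 ?Q \<otimes> \<nabla> S) \<Zsemi> (\<delta> S \<otimes> \<eta> ?Q) \<Zsemi> (\<^bold>! h \<otimes> \<^bold>! h)) \<Zsemi> \<nabla> ?T"
    by (simp add: seq_assoc')
  also have "(\<^bold>1 ?Q \<otimes> \<nabla> S) \<Zsemi> (\<delta> S \<otimes> \<eta> ?Q) \<Zsemi> (\<^bold>! h \<otimes> \<^bold>! h)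
      = (\<delta> S \<Zsemi> \<^bold>! h) \<otimes> (\<nabla> S \<Zsemi> h \<Zsemi> \<eta> ?T)"
    by (simp add: seq_tensor eta_bang seq_assoc')
  also have "(\<^bold>! f \<otimes> g) \<Zsemi> (\<Delta> S \<otimes> \<eta> S) = (\<Delta> A \<otimes> \<^bold>1 B) \<Zsemi> (\<^bold>! f \<otimes> \<^bold>! f \<otimes> (g \<Zsemi> \<eta> S))"
    by (simp add: seq_tensor bang_dupl flip: tensor_assoc')
  also have "\<dots> \<Zsemi> ((\<delta> S \<Zsemi> \<^bold>! h) \<otimes> (\<nabla> S \<Zsemi> h \<Zsemi> \<eta> ?T) \<Zsemi> \<nabla> ?T)
      = (\<Delta> A \<otimes> \<^bold>1 B) \<Zsemi> (((\<^bold>! f \<otimes> (\<^bold>! f \<otimes> (g \<Zsemi> \<eta> S))) \<Zsemi> ((\<delta> S \<Zsemi> \<^bold>! h) \<otimes> (\<nabla> S \<Zsemi> h \<Zsemi> \<eta> ?T))) \<Zsemi> \<nabla> ?T)"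
    by (simp add: seq_assoc')
  also have "(\<^bold>! f \<otimes> (\<^bold>! f \<otimes> (g \<Zsemi> \<eta> S))) \<Zsemi> ((\<delta> S \<Zsemi> \<^bold>! h) \<otimes> (\<nabla> S \<Zsemi> h \<Zsemi> \<eta> ?T))
      = (\<^bold>! f \<Zsemi> (\<delta> S \<Zsemi> \<^bold>! h)) \<otimes> ((\<^bold>! f \<otimes> (g \<Zsemi> \<eta> S)) \<Zsemi> (\<nabla> S \<Zsemi> h) \<Zsemi> \<eta> ?T)"
    by (simp add: seq_tensor seq_assoc')
  also have "\<dots> = (\<^bold>e A \<Zsemi> \<^bold>u ?T) \<otimes> ((\<epsilon> A \<otimes> \<^bold>1 B) \<Zsemi> \<eta> ?T)"
    by (simp only: fh gh)
  also have "\<dots> = (\<^bold>e A \<otimes> ((\<epsilon> A \<otimes> \<^bold>1 B) \<Zsemi> \<eta> ?T)) \<Zsemi> (\<^bold>u ?T \<otimes> \<^bold>1 (\<^bold>!\<^sub>o ?T))"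
    by (simp add: seq_tensor)
  also have "(\<Delta> A \<otimes> \<^bold>1 B) \<Zsemi> (\<dots> \<Zsemi> \<nabla> ?T)
      = (\<Delta> A \<otimes> \<^bold>1 B) \<Zsemi> ((\<^bold>e A \<otimes> ((\<epsilon> A \<otimes> \<^bold>1 B) \<Zsemi> \<eta> ?T)) \<Zsemi> ((\<^bold>u ?T \<otimes> \<^bold>1 (\<^bold>!\<^sub>o ?T)) \<Zsemi> \<nabla> ?T))"
    by (simp add: seq_assoc')
  also have "(\<^bold>e A \<otimes> ((\<epsilon> A \<otimes> \<^bold>1 B) \<Zsemi> \<eta> ?T)) \<Zsemi> ((\<^bold>u ?T \<otimes> \<^bold>1 (\<^bold>!\<^sub>o ?T)) \<Zsemi> \<nabla> ?T)
      = (\<^bold>e A \<otimes> \<^bold>1 (\<^bold>!\<^sub>o A) \<otimes> \<^bold>1 B) \<Zsemi> (\<^bold>1 \<^bold>K \<otimes> ((\<epsilon> A \<otimes> \<^bold>1 B) \<Zsemi> \<eta> ?T))"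
    by (simp add: unit_mult seq_tensor del: unit_tensor')
  also have "(\<Delta> A \<otimes> \<^bold>1 B) \<Zsemi> \<dots>
      = ((\<Delta> A \<Zsemi> (\<^bold>e A \<otimes> \<^bold>1 (\<^bold>!\<^sub>o A))) \<otimes> \<^bold>1 B) \<Zsemi> ((\<epsilon> A \<otimes> \<^bold>1 B) \<Zsemi> \<eta> ?T)"
  proof -
    have "(\<Delta> A \<Zsemi> (\<^bold>e A \<otimes> \<^bold>1 (\<^bold>!\<^sub>o A))) \<otimes> \<^bold>1 B
        = (\<Delta> A \<otimes> \<^bold>1 B) \<Zsemi> ((\<^bold>e A \<otimes> \<^bold>1 (\<^bold>!\<^sub>o A)) \<otimes> \<^bold>1 B)"
      by (simp add: seq_tensor del: tensor_assoc')
    then show ?thesis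
      by (simp add: seq_assoc')
  qed
  also have "\<dots> = (\<epsilon> A \<otimes> \<^bold>1 B) \<Zsemi> \<eta> ?T"
    by (simp add: dupl_disc_left)
  finally show "(\<^bold>1 (\<^bold>!\<^sub>o A) \<otimes> \<eta> B) \<Zsemi> \<^bold>m A B = (\<epsilon> A \<otimes> \<^bold>1 B) \<Zsemi> \<eta> (A \<otimes>\<^sub>o B)" .
qed

text \<open>As \<nabla> is a coalgebra map, \<delta> passes through it onto \<eta>. There the
  alternative chain rule yields a product of \<open>w\<close> and \<open>y\<close>, over which
  \<open>m\<close> distributes, \<Delta> duplicating the argument in \<open>!A\<close>. The factors
  containing \<open>w\<close> and \<open>y\<close> become the two factors under the outer \<nabla>
  of the chain rule.\<close>

lemma monoidal_imp_chain:
  assumes alt: "alternative_chain_rule X \<nabla> \<^bold>u \<eta>" and mon: "monoidal_rule X \<eta>"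
  shows "chain_rule X \<nabla> \<eta>"
  unfolding chain_rule_def
proof
  fix A
  assume A [simp]: "A \<in> Obj X"
  define B where "B = \<^bold>!\<^sub>o A"
  \<comment> \<open>With these two maps the alternative chain rule says that \<eta> followed by
    \<delta> is the product of \<open>w\<close> and \<open>y\<close> under \<nabla>.\<close>
  define w where "w = \<^bold>u A \<Zsemi> \<delta> A"
  define y where "y = \<eta> A \<Zsemi> \<eta> B"
  have [simp]: "B \<in> Obj X" "\<^bold>!\<^sub>o A = B" "arr w" "src w = \<^bold>K" "tgt w = \<^bold>!\<^sub>o B"
    "arr y" "src y = A" "tgt y = \<^bold>!\<^sub>o B"
    by (auto simp: B_def w_def y_def)
  have mult_comult: "\<nabla> A \<Zsemi> \<delta> A = (\<delta> A \<otimes> \<delta> A) \<Zsemi> \<^bold>m B B \<Zsemi> \<^bold>! (\<nabla> A)"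
    using coalg_mor_mult[of A] by (simp add: coalg_mor_def tens_def)
  \<comment> \<open>\<open>mult_comult\<close> read backwards, with \<open>u\<close> as second
    argument, which \<nabla> absorbs.\<close>
  have w: "(\<delta> A \<otimes> w) \<Zsemi> \<^bold>m B B \<Zsemi> \<^bold>! (\<nabla> A) = \<delta> A"
  proof -
    have "\<delta> A \<otimes> w = (\<^bold>1 B \<otimes> \<^bold>u A) \<Zsemi> (\<delta> A \<otimes> \<delta> A)"
      by (simp add: w_def seq_tensor)
    then have "(\<delta> A \<otimes> w) \<Zsemi> \<^bold>m B B \<Zsemi> \<^bold>! (\<nabla> A) = (\<^bold>1 B \<otimes> \<^bold>u A) \<Zsemi> (\<nabla> A \<Zsemi> \<delta> A)"
      by (simp add: mult_comult seq_assoc')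
    also have "\<dots> = ((\<^bold>1 B \<otimes> \<^bold>u A) \<Zsemi> \<nabla> A) \<Zsemi> \<delta> A"
      by (simp add: seq_assoc')
    finally show ?thesis
      by (simp add: mult_unit')
  qed
  \<comment> \<open>The monoidal rule trades \<open>m\<close> for \<epsilon>, which cancels
    \<delta>; naturality of \<eta> then takes \<nabla> out of \<open>!\<close>.\<close>
  have y: "(\<delta> A \<otimes> y) \<Zsemi> \<^bold>m B B \<Zsemi> \<^bold>! (\<nabla> A) = (\<^bold>1 B \<otimes> \<eta> A) \<Zsemi> \<nabla> A \<Zsemi> \<eta> B"
  proof -
    have "\<delta> A \<otimes> y = (\<delta> A \<otimes> \<eta> A) \<Zsemi> (\<^bold>1 (\<^bold>!\<^sub>o B) \<otimes> \<eta> B)"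
      by (simp add: y_def seq_tensor)
    then have "(\<delta> A \<otimes> y) \<Zsemi> \<^bold>m B B \<Zsemi> \<^bold>! (\<nabla> A)
        = (\<delta> A \<otimes> \<eta> A) \<Zsemi> ((\<^bold>1 (\<^bold>!\<^sub>o B) \<otimes> \<eta> B) \<Zsemi> \<^bold>m B B) \<Zsemi> \<^bold>! (\<nabla> A)"
      by (simp add: seq_assoc')
    also have "(\<^bold>1 (\<^bold>!\<^sub>o B) \<otimes> \<eta> B) \<Zsemi> \<^bold>m B B = (\<epsilon> B \<otimes> \<^bold>1 B) \<Zsemi> \<eta> (B \<otimes>\<^sub>o B)"
      using mon by (simp add: monoidal_rule_def)
    also have "(\<delta> A \<otimes> \<eta> A) \<Zsemi> \<dots> \<Zsemi> \<^bold>! (\<nabla> A)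
        = ((\<delta> A \<otimes> \<eta> A) \<Zsemi> (\<epsilon> B \<otimes> \<^bold>1 B)) \<Zsemi> (\<eta> (B \<otimes>\<^sub>o B) \<Zsemi> \<^bold>! (\<nabla> A))"
      by (simp add: seq_assoc')
    also have "(\<delta> A \<otimes> \<eta> A) \<Zsemi> (\<epsilon> B \<otimes> \<^bold>1 B) = \<^bold>1 B \<otimes> \<eta> A"
      using comult_counit[of A] by (simp add: seq_tensor)
    also have "\<eta> (B \<otimes>\<^sub>o B) \<Zsemi> \<^bold>! (\<nabla> A) = \<nabla> A \<Zsemi> \<eta> B"
      by (simp add: eta_bang)
    finally show ?thesis
      by (simp add: seq_assoc')
  qed
  let ?M = "middle (\<^bold>!\<^sub>o B) (\<^bold>!\<^sub>o B) (\<^bold>!\<^sub>o B) (\<^bold>!\<^sub>o B)"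
  have "(\<^bold>1 B \<otimes> \<eta> A) \<Zsemi> \<nabla> A \<Zsemi> \<delta> A = ((\<^bold>1 B \<otimes> \<eta> A) \<Zsemi> (\<delta> A \<otimes> \<delta> A)) \<Zsemi> \<^bold>m B B \<Zsemi> \<^bold>! (\<nabla> A)"
    by (simp add: mult_comult seq_assoc')
  also have "(\<^bold>1 B \<otimes> \<eta> A) \<Zsemi> (\<delta> A \<otimes> \<delta> A) = \<delta> A \<otimes> (\<eta> A \<Zsemi> \<delta> A)"
    by (simp add: seq_tensor)
  also have "\<eta> A \<Zsemi> \<delta> A = (\<^bold>u A \<otimes> \<eta> A) \<Zsemi> (\<delta> A \<otimes> \<eta> B) \<Zsemi> \<nabla> B"
    using alt by (simp add: alternative_chain_rule_def)
  also have "(\<^bold>u A \<otimes> \<eta> A) \<Zsemi> (\<delta> A \<otimes> \<eta> B) = w \<otimes> y"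
    by (simp add: w_def y_def seq_tensor)
  also have "\<delta> A \<otimes> ((w \<otimes> y) \<Zsemi> \<nabla> B) = (\<delta> A \<otimes> w \<otimes> y) \<Zsemi> (\<^bold>1 (\<^bold>!\<^sub>o B) \<otimes> \<nabla> B)"
    by (simp add: seq_tensor)
  also have "\<dots> \<Zsemi> \<^bold>m B B = (\<delta> A \<otimes> w \<otimes> y) \<Zsemi> ((\<^bold>1 (\<^bold>!\<^sub>o B) \<otimes> \<nabla> B) \<Zsemi> \<^bold>m B B)"
    by (simp add: seq_assoc')
  also have "\<dots> = ((\<delta> A \<otimes> (w \<otimes> y)) \<Zsemi> (\<Delta> B \<otimes> \<^bold>1 (\<^bold>!\<^sub>o B \<otimes>\<^sub>o \<^bold>!\<^sub>o B))) \<Zsemi> ?M \<Zsemi> (\<^bold>m B B \<otimes> \<^bold>m B B) \<Zsemi> \<nabla> (B \<otimes>\<^sub>o B)"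
    by (simp add: m_mult seq_assoc')
  also have "(\<delta> A \<otimes> (w \<otimes> y)) \<Zsemi> (\<Delta> B \<otimes> \<^bold>1 (\<^bold>!\<^sub>o B \<otimes>\<^sub>o \<^bold>!\<^sub>o B)) = (\<Delta> A \<otimes> \<^bold>1 A) \<Zsemi> ((\<delta> A \<otimes> \<delta> A) \<otimes> (w \<otimes> y))"
    using comult_dupl[of A] by (simp add: seq_tensor del: tensor_assoc')
  \<comment> \<open>Because \<open>w\<close> starts at the unit object, the exchange is trivial once
    moved to the sources.\<close>
  also have "\<dots> \<Zsemi> ?M = (\<Delta> A \<otimes> \<^bold>1 A) \<Zsemi> (\<delta> A \<otimes> w \<otimes> \<delta> A \<otimes> y)"
    using middle_natural[of "\<delta> A" "\<delta> A" w y] by (simp add: seq_assoc' middle_def[of B B "\<^bold>K" A])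
  also have "\<dots> \<Zsemi> (\<^bold>m B B \<otimes> \<^bold>m B B) \<Zsemi> \<nabla> (B \<otimes>\<^sub>o B) \<Zsemi> \<^bold>! (\<nabla> A)
      = (\<Delta> A \<otimes> \<^bold>1 A) \<Zsemi> (((\<delta> A \<otimes> w) \<otimes> (\<delta> A \<otimes> y)) \<Zsemi> (\<^bold>m B B \<otimes> \<^bold>m B B) \<Zsemi> (\<^bold>! (\<nabla> A) \<otimes> \<^bold>! (\<nabla> A)) \<Zsemi> \<nabla> B)"
    by (simp add: seq_assoc' mult_natural)
  also have "((\<delta> A \<otimes> w) \<otimes> (\<delta> A \<otimes> y)) \<Zsemi> (\<^bold>m B B \<otimes> \<^bold>m B B) \<Zsemi> (\<^bold>! (\<nabla> A) \<otimes> \<^bold>! (\<nabla> A))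
      = \<delta> A \<otimes> ((\<^bold>1 B \<otimes> \<eta> A) \<Zsemi> \<nabla> A \<Zsemi> \<eta> B)"
    by (simp add: seq_tensor w y del: tensor_assoc')
  also have "\<dots> = (\<^bold>1 B \<otimes> (\<^bold>1 B \<otimes> \<eta> A)) \<Zsemi> (\<^bold>1 B \<otimes> \<nabla> A) \<Zsemi> (\<delta> A \<otimes> \<eta> B)"
    by (simp add: seq_tensor del: tensor_ident)
  also have "(\<Delta> A \<otimes> \<^bold>1 A) \<Zsemi> (\<dots> \<Zsemi> \<nabla> B)
      = ((\<Delta> A \<otimes> \<^bold>1 A) \<Zsemi> (\<^bold>1 (B \<otimes>\<^sub>o B) \<otimes> \<eta> A)) \<Zsemi> (\<^bold>1 B \<otimes> \<nabla> A) \<Zsemi> (\<delta> A \<otimes> \<eta> B) \<Zsemi> \<nabla> B"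
    by (simp add: seq_assoc' flip: tensor_ident)
  also have "(\<Delta> A \<otimes> \<^bold>1 A) \<Zsemi> (\<^bold>1 (B \<otimes>\<^sub>o B) \<otimes> \<eta> A) = \<Delta> A \<otimes> \<eta> A"
    by (simp add: seq_tensor)
  finally show "(\<^bold>1 (\<^bold>!\<^sub>o A) \<otimes> \<eta> A) \<Zsemi> \<nabla> A \<Zsemi> \<delta> A
      = (\<Delta> A \<otimes> \<eta> A) \<Zsemi> (\<^bold>1 (\<^bold>!\<^sub>o A) \<otimes> \<nabla> A) \<Zsemi> (\<delta> A \<otimes> \<eta> (\<^bold>!\<^sub>o A)) \<Zsemi> \<nabla> (\<^bold>!\<^sub>o A)"
    by simp
qed

end

theorem corollary6p6:
  fixes X :: "('o, 'a, 'z) monoidal_coalgebra_modality_scheme" (structure)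
    and \<eta> :: "'o \<Rightarrow> 'a"
  assumes "additive_linear_category X"
    and "natural_transformation X (\<lambda>A. A) (\<lambda>f. f) \<^bold>!\<^sub>o \<^bold>! \<eta>"
  shows "(codereliction X \<nabla> \<^bold>u \<eta> \<longleftrightarrow>
            linear_rule X \<eta> \<and> chain_rule X \<nabla> \<eta>) \<and>
         (linear_rule X \<eta> \<and> chain_rule X \<nabla> \<eta> \<longleftrightarrow>
            linear_rule X \<eta> \<and> alternative_chain_rule X \<nabla> \<^bold>u \<eta> \<and> monoidal_rule X \<eta>)"
proof (cases "linear_rule X \<eta>")
  case True
  then interpret linear_natural X \<eta>
    using assms by (simp add: linear_natural_def linear_natural_axioms_def)
  show ?thesis
    using codereliction_iff chain_imp_alternative_chain chain_imp_monoidal monoidal_imp_chain True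
    by blast
next
  case False
  then show ?thesis
    by (simp add: codereliction_def)
qed

end
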